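(* A finite group $\Gamma$ and a short exact sequence of $\Gamma$-modules $$0\to B_1\xrightarrow{\ i\ } B_2\xrightarrow{\ j\ } B_3\to 0$$ give rise to an exact sequence $$(B_1)_{\Gamma,\mathrm{Tors}} \xrightarrow{i_*} (B_2)_{\Gamma,\mathrm{Tors}} \xrightarrow{j_*} (B_3)_{\Gamma,\mathrm{Tors}}\xrightarrow{\ \delta\ } \mathbb Q/\mathbb Z\otimes_{\mathbb Z} (B_1)_\Gamma \xrightarrow{i_*} \mathbb Q/\mathbb Z\otimes_{\mathbb Z}(B_2)_\Gamma \xrightarrow{j_*} \mathbb Q/\mathbb Z\otimes_{\mathbb Z}(B_3)_\Gamma\to 0$$ depending functorially on $\Gamma$ and on the given short exact sequence, where $\delta$ is the homomorphism specified in the context.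
   Context: For a finite group $\Gamma$ and a $\Gamma$-module $B$, $B_\Gamma$ denotes the group of coinvariants, that is, the quotient of $B$ by the subgroup generated by the elements ${}^\gamma b-b$ ($\gamma\in\Gamma$, $b\in B$). $B_{\Gamma,\mathrm{Tors}}=(B_\Gamma)_{\mathrm{Tors}}$ is its torsion subgroup, and $B_{\Gamma,\mathrm{t.f.}}=B_\Gamma/B_{\Gamma,\mathrm{Tors}}$. The maps $i_*$, $j_*$ are induced by $i$, $j$. The homomorphism $\delta$: let $x_3\in B_3$ be such that its image $(x_3)_\Gamma$ in $(B_3)_\Gamma$ lies in $(B_3)_{\Gamma,\mathrm{Tors}}$. Then there exist an integer $n>0$ and elements $y_{3,\gamma}\in B_3$ with $nx_3=\sum_{\gamma\in\Gamma}({}^\gamma y_{3,\gamma}-y_{3,\gamma})$. Lift $x_3$ to $x_2\in B_2$ and each $y_{3,\gamma}$ to $y_{2,\gamma}\in B_2$, and put $z_2=nx_2-\sum_{\gamma\in\Gamma}({}^\gamma y_{2,\gamma}-y_{2,\gamma})$. Then $j(z_2)=0$, so $z_2=i(z_1)$ with $z_1\in B_1$. Let $(z_1)_{\Gamma,\mathrm{t.f.}}$ be the image of $z_1$ in $(B_1)_{\Gamma,\mathrm{t.f.}}$, and put $$\delta\big((x_3)_\Gamma\big)=\tfrac1n\otimes (z_1)_{\Gamma,\mathrm{t.f.}}\in\mathbb Q/\mathbb Z\otimes_{\mathbb Z}(B_1)_{\Gamma,\mathrm{t.f.}}=\mathbb Q/\mathbb Z\otimes_{\mathbb Z}(B_1)_\Gamma,$$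 where $\frac1n$ denotes the image of $\frac1n\in\mathbb Q$ in $\mathbb Q/\mathbb Z$. *)

theory Defs
  imports "HOL-Algebra.Bij" "HOL-Algebra.Exact_Sequence" "HOL-Algebra.Free_Abelian_Groups"
begin

text \<open>
  Abelian groups are written multiplicatively, as \<^const>\<open>comm_group\<close>s of HOL-Algebra:
  a sum \<open>\<Sum>\<close> is a \<^const>\<open>finprod\<close>, \<open>n x\<close> is \<open>x [^] n\<close>, and \<open>\<^sup>\<gamma>b - b\<close> is \<open>act B \<gamma> b \<otimes> inv b\<close>.
\<close>

subsection \<open>Induced maps on quotients, torsion\<close>

text \<open>The map \<open>G Mod K \<rightarrow> H Mod N\<close> induced by \<open>h : G \<rightarrow> H\<close> with \<open>h(K) \<subseteq> N\<close>; its argument \<open>C\<close> is a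
  coset of \<open>K\<close>, so \<open>K\<close> itself need not be mentioned.\<close>

definition quot_map :: "('b, 'm) monoid_scheme \<Rightarrow> 'b set \<Rightarrow> ('a \<Rightarrow> 'b) \<Rightarrow> 'a set \<Rightarrow> 'b set" where
  "quot_map H N h C = the_elem ((\<lambda>x. N #>\<^bsub>H\<^esub> h x) ` C)"

definition torsion :: "('a, 'm) monoid_scheme \<Rightarrow> 'a set" where
  "torsion A = {x \<in> carrier A. \<exists>n::nat. n > 0 \<and> x [^]\<^bsub>A\<^esub> n = \<one>\<^bsub>A\<^esub>}"

definition Tors :: "'a monoid \<Rightarrow> 'a monoid" where
  "Tors A = A\<lparr>carrier := torsion A\<rparr>"

definition tors_free :: "('a, 'm) monoid_scheme \<Rightarrow> 'a set monoid" where
  "tors_free A = A Mod torsion A"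

definition tors_free_proj :: "('a, 'm) monoid_scheme \<Rightarrow> 'a \<Rightarrow> 'a set" where
  "tors_free_proj A x = torsion A #>\<^bsub>A\<^esub> x"

text \<open>Exactness of \<open>A \<rightarrow> B \<rightarrow> C\<close> at \<open>B\<close>. The library's \<^const>\<open>exact_seq\<close> forces all groups of the
  sequence to have the same element type.\<close>

definition exact_at ::
  "('a, 'k) monoid_scheme \<Rightarrow> ('a \<Rightarrow> 'b) \<Rightarrow> ('b, 'm) monoid_scheme \<Rightarrow> ('b \<Rightarrow> 'c) \<Rightarrow>
   ('c, 'n) monoid_scheme \<Rightarrow> bool" where
  "exact_at A f B g C \<longleftrightarrow> group_hom A B f \<and> group_hom B C g \<and> f ` carrier A = kernel B C g"

subsection \<open>Tensor products of abelian groups and \<open>\<rat>/\<int>\<close>\<close>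

definition tensor_rel :: "('a, 'm) monoid_scheme \<Rightarrow> ('b, 'n) monoid_scheme \<Rightarrow> ('a \<times> 'b \<Rightarrow>\<^sub>0 int) set" where
  "tensor_rel A B = generate (free_Abelian_group (carrier A \<times> carrier B))
     ({frag_of (a \<otimes>\<^bsub>A\<^esub> a', b) - frag_of (a, b) - frag_of (a', b) | a a' b.
         a \<in> carrier A \<and> a' \<in> carrier A \<and> b \<in> carrier B}
    \<union> {frag_of (a, b \<otimes>\<^bsub>B\<^esub> b') - frag_of (a, b) - frag_of (a, b') | a b b'.
         a \<in> carrier A \<and> b \<in> carrier B \<and> b' \<in> carrier B})"

definition tensor :: "('a, 'm) monoid_scheme \<Rightarrow> ('b, 'n) monoid_scheme \<Rightarrow> ('a \<times> 'b \<Rightarrow>\<^sub>0 int) set monoid" where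
  "tensor A B = free_Abelian_group (carrier A \<times> carrier B) Mod tensor_rel A B"

definition pure_tensor ::
  "('a, 'm) monoid_scheme \<Rightarrow> ('b, 'n) monoid_scheme \<Rightarrow> 'a \<Rightarrow> 'b \<Rightarrow> ('a \<times> 'b \<Rightarrow>\<^sub>0 int) set" where
  "pure_tensor A B a b =
     tensor_rel A B #>\<^bsub>free_Abelian_group (carrier A \<times> carrier B)\<^esub> frag_of (a, b)"

text \<open>\<open>f \<otimes> g\<close>, where \<open>A'\<close> and \<open>B'\<close> are the target groups of \<open>f\<close> and \<open>g\<close>.\<close>

definition tensor_map ::
  "('c, 'm) monoid_scheme \<Rightarrow> ('d, 'n) monoid_scheme \<Rightarrow> ('a \<Rightarrow> 'c) \<Rightarrow> ('b \<Rightarrow> 'd) \<Rightarrow>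
   ('a \<times> 'b \<Rightarrow>\<^sub>0 int) set \<Rightarrow> ('c \<times> 'd \<Rightarrow>\<^sub>0 int) set" where
  "tensor_map A' B' f g =
     quot_map (free_Abelian_group (carrier A' \<times> carrier B')) (tensor_rel A' B')
       (frag_extend (\<lambda>(a, b). frag_of (f a, g b)))"

definition rat_group :: "rat monoid" where
  "rat_group = \<lparr>carrier = UNIV, mult = (+), one = 0\<rparr>"

definition QZ :: "rat set monoid" where
  "QZ = rat_group Mod \<int>"

definition QZ_class :: "rat \<Rightarrow> rat set" where
  "QZ_class q = \<int> #>\<^bsub>rat_group\<^esub> q"

subsection \<open>\<open>\<Gamma>\<close>-modules and coinvariants\<close>

record ('g, 'a) gmodule = "'a monoid" +
  act :: "'g \<Rightarrow> 'a \<Rightarrow> 'a"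

definition is_gmodule :: "'g monoid \<Rightarrow> ('g, 'a) gmodule \<Rightarrow> bool" where
  "is_gmodule \<Gamma> B \<longleftrightarrow> group \<Gamma> \<and> comm_group B \<and> act B \<in> hom \<Gamma> (AutoGroup B)"

definition gmodule_hom ::
  "'g monoid \<Rightarrow> ('g \<Rightarrow> 'h) \<Rightarrow> ('g, 'a) gmodule \<Rightarrow> ('h, 'b) gmodule \<Rightarrow> ('a \<Rightarrow> 'b) set" where
  "gmodule_hom \<Gamma> \<phi> B B' =
     {f \<in> hom B B'. \<forall>\<gamma>\<in>carrier \<Gamma>. \<forall>b\<in>carrier B. f (act B \<gamma> b) = act B' (\<phi> \<gamma>) (f b)}"

definition coinv_rel :: "'g monoid \<Rightarrow> ('g, 'a) gmodule \<Rightarrow> 'a set" where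
  "coinv_rel \<Gamma> B =
     generate B {act B \<gamma> b \<otimes>\<^bsub>B\<^esub> inv\<^bsub>B\<^esub> b | \<gamma> b. \<gamma> \<in> carrier \<Gamma> \<and> b \<in> carrier B}"

definition coinv :: "'g monoid \<Rightarrow> ('g, 'a) gmodule \<Rightarrow> 'a set monoid" where
  "coinv \<Gamma> B = B Mod coinv_rel \<Gamma> B"

definition coinv_class :: "'g monoid \<Rightarrow> ('g, 'a) gmodule \<Rightarrow> 'a \<Rightarrow> 'a set" where
  "coinv_class \<Gamma> B b = coinv_rel \<Gamma> B #>\<^bsub>B\<^esub> b"

text \<open>\<open>f\<^sub>*\<close> on coinvariants for \<open>f\<close> with values in the \<open>\<Gamma>'\<close>-module \<open>B'\<close>. The map between the
  torsion subgroups is its restriction.\<close>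

definition coinv_map :: "'h monoid \<Rightarrow> ('h, 'b) gmodule \<Rightarrow> ('a \<Rightarrow> 'b) \<Rightarrow> 'a set \<Rightarrow> 'b set" where
  "coinv_map \<Gamma>' B' f = quot_map B' (coinv_rel \<Gamma>' B') f"

definition QZ_coinv :: "'g monoid \<Rightarrow> ('g, 'a) gmodule \<Rightarrow> (rat set \<times> 'a set \<Rightarrow>\<^sub>0 int) set monoid" where
  "QZ_coinv \<Gamma> B = tensor QZ (coinv \<Gamma> B)"

definition QZ_coinv_map ::
  "'h monoid \<Rightarrow> ('h, 'b) gmodule \<Rightarrow> ('a \<Rightarrow> 'b) \<Rightarrow>
   (rat set \<times> 'a set \<Rightarrow>\<^sub>0 int) set \<Rightarrow> (rat set \<times> 'b set \<Rightarrow>\<^sub>0 int) set" where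
  "QZ_coinv_map \<Gamma>' B' f = tensor_map QZ (coinv \<Gamma>' B') id (coinv_map \<Gamma>' B' f)"

text \<open>The canonical map \<open>\<rat>/\<int> \<otimes> B\<^sub>\<Gamma> \<rightarrow> \<rat>/\<int> \<otimes> B\<^sub>\<Gamma>\<^sub>,\<^sub>t\<^sub>.\<^sub>f\<^sub>.\<close> by which these two groups are identified.\<close>

definition QZ_coinv_tf ::
  "'g monoid \<Rightarrow> ('g, 'a) gmodule \<Rightarrow>
   (rat set \<times> 'a set \<Rightarrow>\<^sub>0 int) set \<Rightarrow> (rat set \<times> 'a set set \<Rightarrow>\<^sub>0 int) set" where
  "QZ_coinv_tf \<Gamma> B =
     tensor_map QZ (tors_free (coinv \<Gamma> B)) id (tors_free_proj (coinv \<Gamma> B))"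

subsection \<open>Short exact sequences and the homomorphism \<open>\<delta>\<close>\<close>

record ('g, 'a, 'b, 'c) gmod_seq =
  Grp :: "'g monoid"
  M1 :: "('g, 'a) gmodule"
  M2 :: "('g, 'b) gmodule"
  M3 :: "('g, 'c) gmodule"
  inc :: "'a \<Rightarrow> 'b"
  prj :: "'b \<Rightarrow> 'c"

definition short_exact :: "('g, 'a, 'b, 'c) gmod_seq \<Rightarrow> bool" where
  "short_exact S \<longleftrightarrow>
     group (Grp S) \<and> finite (carrier (Grp S)) \<and>
     is_gmodule (Grp S) (M1 S) \<and> is_gmodule (Grp S) (M2 S) \<and> is_gmodule (Grp S) (M3 S) \<and>
     inc S \<in> gmodule_hom (Grp S) id (M1 S) (M2 S) \<and>
     prj S \<in> gmodule_hom (Grp S) id (M2 S) (M3 S) \<and>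
     inj_on (inc S) (carrier (M1 S)) \<and>
     exact_at (M1 S) (inc S) (M2 S) (prj S) (M3 S) \<and>
     prj S ` carrier (M2 S) = carrier (M3 S)"

text \<open>A morphism of short exact sequences over a homomorphism \<open>\<phi>\<close> of the acting groups.\<close>

definition seq_hom ::
  "('g, 'a, 'b, 'c) gmod_seq \<Rightarrow> ('h, 'd, 'e, 'f) gmod_seq \<Rightarrow>
   ('g \<Rightarrow> 'h) \<Rightarrow> ('a \<Rightarrow> 'd) \<Rightarrow> ('b \<Rightarrow> 'e) \<Rightarrow> ('c \<Rightarrow> 'f) \<Rightarrow> bool" where
  "seq_hom S S' \<phi> f1 f2 f3 \<longleftrightarrow>
     \<phi> \<in> hom (Grp S) (Grp S') \<and>
     f1 \<in> gmodule_hom (Grp S) \<phi> (M1 S) (M1 S') \<and>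
     f2 \<in> gmodule_hom (Grp S) \<phi> (M2 S) (M2 S') \<and>
     f3 \<in> gmodule_hom (Grp S) \<phi> (M3 S) (M3 S') \<and>
     (\<forall>x\<in>carrier (M1 S). f2 (inc S x) = inc S' (f1 x)) \<and>
     (\<forall>x\<in>carrier (M2 S). f3 (prj S x) = prj S' (f2 x))"

definition act_sum :: "'g monoid \<Rightarrow> ('g, 'a) gmodule \<Rightarrow> ('g \<Rightarrow> 'a) \<Rightarrow> 'a" where
  "act_sum \<Gamma> B y = finprod B (\<lambda>\<gamma>. act B \<gamma> (y \<gamma>) \<otimes>\<^bsub>B\<^esub> inv\<^bsub>B\<^esub> (y \<gamma>)) (carrier \<Gamma>)"

text \<open>\<open>delta_data S x3 n z1\<close>: some choice of \<open>y\<^sub>3\<^sub>,\<^sub>\<gamma>\<close>, \<open>x\<^sub>2\<close>, \<open>y\<^sub>2\<^sub>,\<^sub>\<gamma>\<close> in the construction of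
  \<open>\<delta>((x\<^sub>3)\<^sub>\<Gamma>)\<close> leads to the integer \<open>n\<close> and the element \<open>z\<^sub>1\<close>.\<close>

definition delta_data :: "('g, 'a, 'b, 'c) gmod_seq \<Rightarrow> 'c \<Rightarrow> nat \<Rightarrow> 'a \<Rightarrow> bool" where
  "delta_data S x3 n z1 \<longleftrightarrow>
     x3 \<in> carrier (M3 S) \<and> n > 0 \<and> z1 \<in> carrier (M1 S) \<and>
     (\<exists>y3 x2 y2.
        y3 \<in> carrier (Grp S) \<rightarrow> carrier (M3 S) \<and>
        x3 [^]\<^bsub>M3 S\<^esub> n = act_sum (Grp S) (M3 S) y3 \<and>
        x2 \<in> carrier (M2 S) \<and> prj S x2 = x3 \<and>
        y2 \<in> carrier (Grp S) \<rightarrow> carrier (M2 S) \<and>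
        (\<forall>\<gamma>\<in>carrier (Grp S). prj S (y2 \<gamma>) = y3 \<gamma>) \<and>
        inc S z1 = x2 [^]\<^bsub>M2 S\<^esub> n \<otimes>\<^bsub>M2 S\<^esub> inv\<^bsub>M2 S\<^esub> act_sum (Grp S) (M2 S) y2)"

text \<open>\<open>1/n \<otimes> (z\<^sub>1)\<^sub>\<Gamma>\<^sub>,\<^sub>t\<^sub>.\<^sub>f\<^sub>.\<close>\<close>

definition delta_value ::
  "('g, 'a, 'b, 'c) gmod_seq \<Rightarrow> nat \<Rightarrow> 'a \<Rightarrow> (rat set \<times> 'a set set \<Rightarrow>\<^sub>0 int) set" where
  "delta_value S n z1 =
     pure_tensor QZ (tors_free (coinv (Grp S) (M1 S))) (QZ_class (1 / of_nat n))
       (tors_free_proj (coinv (Grp S) (M1 S)) (coinv_class (Grp S) (M1 S) z1))"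

text \<open>\<open>\<delta>\<close> takes its values in \<open>\<rat>/\<int> \<otimes> (B\<^sub>1)\<^sub>\<Gamma>\<close>; they are described through the identification with
  \<open>\<rat>/\<int> \<otimes> (B\<^sub>1)\<^sub>\<Gamma>\<^sub>,\<^sub>t\<^sub>.\<^sub>f\<^sub>.\<close>. That the description is independent of all choices is not built in.\<close>

definition delta :: "('g, 'a, 'b, 'c) gmod_seq \<Rightarrow> 'c set \<Rightarrow> (rat set \<times> 'a set \<Rightarrow>\<^sub>0 int) set" where
  "delta S c = (THE t. t \<in> carrier (QZ_coinv (Grp S) (M1 S)) \<and>
     (\<exists>x3 n z1. delta_data S x3 n z1 \<and> coinv_class (Grp S) (M3 S) x3 = c \<and>
        QZ_coinv_tf (Grp S) (M1 S) t = delta_value S n z1))"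

end

theory Submission
  imports Defs
begin

text \<open>
  Write \<open>A\<^sub>k\<close> for the coinvariants of \<open>B\<^sub>k\<close>. Taking coinvariants is right exact, so
  \<open>A\<^sub>1 \<rightarrow> A\<^sub>2 \<rightarrow> A\<^sub>3 \<rightarrow> 0\<close> is exact. Since \<open>\<Gamma>\<close> is finite, the
  kernel of \<open>i\<^sub>* : A\<^sub>1 \<rightarrow> A\<^sub>2\<close> is moreover torsion (\<open>inc_coinv_one_imp_torsion\<close>). Instead of identifying that
  kernel with a quotient of the group \<open>H\<^sub>1(\<Gamma>, B\<^sub>3)\<close>, which is killed by \<open>|\<Gamma>|\<close>, one can use the norm
  \<open>N b = \<Sum>\<^sub>\<gamma> \<^sup>\<gamma>b\<close>. It vanishes on the elements \<open>\<^sup>\<gamma>b - b\<close>, commutes with \<open>i\<close>, and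
  satisfies \<open>N b \<equiv> |\<Gamma>| b\<close> in the coinvariants. If \<open>i x\<close> dies in \<open>A\<^sub>2\<close>, then \<open>i (N x) = N (i x) = 0\<close>,
  so \<open>N x = 0\<close> by injectivity of \<open>i\<close>, and \<open>|\<Gamma>| x\<close> dies in \<open>A\<^sub>1\<close>.

  From here on the modules can be forgotten: the six-term sequence exists for every exact sequence \<open>A\<^sub>1 \<rightarrow> A\<^sub>2 \<rightarrow> A\<^sub>3 \<rightarrow> 0\<close> of abelian groups in
  which \<open>A\<^sub>1 \<rightarrow> A\<^sub>2\<close> has torsion kernel (locale \<open>torsion_kernel_sequence\<close>). For a torsion element \<open>c\<close>
  of \<open>A\<^sub>3\<close>, lift \<open>c\<close> to \<open>a\<close> in \<open>A\<^sub>2\<close>, choose \<open>n > 0\<close> with \<open>n c = 0\<close>, write \<open>n a = i z\<close>, and set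
  \<open>\<delta> c = 1/n \<otimes> z\<close>. To check that this is well defined and that the sequence is exact, two
  facts about \<open>\<rat>/\<int> \<otimes> A\<close> suffice besides bilinearity: each of its elements has the form \<open>1/n \<otimes> z\<close>
  (\<open>tensor_QZ_fracE\<close>), and
  \<open>1/n \<otimes> z = 0\<close> exactly when \<open>z \<in> n A + A\<^sub>T\<^sub>o\<^sub>r\<^sub>s\<close>
  (\<open>frac_tensor_eq_one_iff\<close>). The second fact also yields the identification of \<open>\<rat>/\<int> \<otimes> A\<close> with
  \<open>\<rat>/\<int> \<otimes> A\<^sub>t\<^sub>.\<^sub>f\<^sub>.\<close>. Its nontrivial direction needs a way to detect that a tensor is nonzero:
  the map \<open>q \<otimes> a \<mapsto> (N q) a\<close> into \<open>A / (N A + A\<^sub>T\<^sub>o\<^sub>r\<^sub>s)\<close> is defined and bilinear once \<open>N\<close> is a multiple of the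
  denominators involved (\<open>tensor_rel_numerators_divisible\<close>).

  The element \<open>\<delta> c\<close> depends only on the relation \<open>connects\<close> between \<open>c\<close> and \<open>(n, z)\<close>, which a
  morphism of sequences preserves; hence \<open>\<delta>\<close> is natural. The remaining squares and the
  functor laws are checked on classes of elements and on tensors \<open>1/n \<otimes> z\<close>.
\<close>


section \<open>Quotients of abelian groups\<close>

lemma comm_group_is_group: "comm_group G \<Longrightarrow> group G"
  by (simp add: comm_group_def)

lemma subgroup_imp_normal_comm: "comm_group G \<Longrightarrow> subgroup K G \<Longrightarrow> K \<lhd> G"
  by (simp add: comm_group.normal_iff_subgroup)

lemma group_homI: "group G \<Longrightarrow> group H \<Longrightarrow> f \<in> hom G H \<Longrightarrow> group_hom G H f"
  by (simp add: group_hom_def group_hom_axioms_def)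

lemma r_coset_eq_iff:
  assumes "group G" "subgroup K G" "x \<in> carrier G" "y \<in> carrier G"
  shows "K #>\<^bsub>G\<^esub> x = K #>\<^bsub>G\<^esub> y \<longleftrightarrow> x \<otimes>\<^bsub>G\<^esub> inv\<^bsub>G\<^esub> y \<in> K"
proof -
  interpret group G by fact
  interpret subgroup K G by fact
  show ?thesis
    by (metis assms(2-4) is_group rcos_module rcos_self repr_independence)
qed

lemma r_coset_eq_subgroup_iff:
  assumes "group G" "subgroup K G" "x \<in> carrier G"
  shows "K #>\<^bsub>G\<^esub> x = K \<longleftrightarrow> x \<in> K"
proof -
  interpret group G by fact
  show ?thesis
    using r_coset_eq_iff[OF assms one_closed] assms by (simp add: coset_mult_one subgroup.subset)
qed

lemma r_coset_hom:
  assumes "comm_group G" "subgroup K G"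
  shows "(\<lambda>x. K #>\<^bsub>G\<^esub> x) \<in> hom G (G Mod K)"
  using normal.r_coset_hom_Mod[OF subgroup_imp_normal_comm[OF assms]] .

text \<open>All elements of the coset \<open>K x\<close> have the same image in \<open>H / N\<close> because \<open>h\<close> maps \<open>K\<close> into \<open>N\<close>, so
  \<^const>\<open>the_elem\<close> in the definition of \<^const>\<open>quot_map\<close> is applied to a singleton.\<close>

lemma quot_map_r_coset:
  assumes "group G" "group H" "subgroup K G" "subgroup N H" "h \<in> hom G H" "h ` K \<subseteq> N"
    and x: "x \<in> carrier G"
  shows "quot_map H N h (K #>\<^bsub>G\<^esub> x) = N #>\<^bsub>H\<^esub> h x"
proof -
  interpret group_hom G H h using assms by (simp add: group_homI)
  have K: "k \<in> carrier G" if "k \<in> K" for k using assms(3) that by (rule subgroup.mem_carrier)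
  have "N #>\<^bsub>H\<^esub> h (k \<otimes>\<^bsub>G\<^esub> x) = N #>\<^bsub>H\<^esub> h x" if "k \<in> K" for k
  proof -
    have "h k \<in> N" using that assms by blast
    then show ?thesis
      using K[OF that] x assms
      by (simp add: r_coset_eq_iff[OF assms(2,4)] H.m_assoc)
  qed
  moreover have "x \<in> K #>\<^bsub>G\<^esub> x" using x assms by (intro group.rcos_self)
  moreover have "\<And>y. y \<in> K #>\<^bsub>G\<^esub> x \<Longrightarrow> \<exists>k\<in>K. y = k \<otimes>\<^bsub>G\<^esub> x" by (auto simp: r_coset_def)
  ultimately have "(\<lambda>y. N #>\<^bsub>H\<^esub> h y) ` (K #>\<^bsub>G\<^esub> x) = {N #>\<^bsub>H\<^esub> h x}"
    by blast
  then show ?thesis by (simp add: quot_map_def)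
qed

lemma quot_map_hom:
  assumes "comm_group G" "comm_group H" "subgroup K G" "subgroup N H" "h \<in> hom G H" "h ` K \<subseteq> N"
  shows "quot_map H N h \<in> hom (G Mod K) (H Mod N)"
proof -
  note p = hom_mult[OF r_coset_hom[OF assms(1,3)]] hom_mult[OF r_coset_hom[OF assms(2,4)]]
  interpret group_hom G H h
    using assms by (intro group_homI comm_group_is_group)
  note q = quot_map_r_coset[OF G.is_group H.is_group assms(3-6)]
  have "quot_map H N h ((K #>\<^bsub>G\<^esub> x) \<otimes>\<^bsub>G Mod K\<^esub> (K #>\<^bsub>G\<^esub> y))
      = quot_map H N h (K #>\<^bsub>G\<^esub> x) \<otimes>\<^bsub>H Mod N\<^esub> quot_map H N h (K #>\<^bsub>G\<^esub> y)"
    if "x \<in> carrier G" "y \<in> carrier G" for x y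
    using that by (simp add: p[symmetric] q del: mult_FactGroup)
  then show ?thesis
    by (auto simp: hom_def carrier_FactGroup q)
qed

lemma generate_superset: "X \<subseteq> generate G X"
  by (auto intro: generate.incl)

lemma hom_generate_subset:
  assumes "group G" "group H" "h \<in> hom G H" "X \<subseteq> carrier G" "subgroup N H" "h ` X \<subseteq> N"
  shows "h ` generate G X \<subseteq> N"
proof -
  interpret group_hom G H h using assms by (simp add: group_homI)
  show ?thesis
    using generate_img[OF assms(4)] H.generate_subgroup_incl[OF assms(6,5)] by simp
qed

lemma torsion_imp_carrier: "x \<in> torsion A \<Longrightarrow> x \<in> carrier A"
  by (simp add: torsion_def)

lemma torsion_subgroup:
  assumes "comm_group A" shows "subgroup (torsion A) A"
proof -
  interpret comm_group A by fact
  show ?thesis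
  proof (rule subgroupI)
    have "\<one>\<^bsub>A\<^esub> \<in> torsion A" by (auto simp: torsion_def intro: exI[of _ 1])
    then show "torsion A \<noteq> {}" by blast
    fix x assume "x \<in> torsion A"
    then obtain n :: nat where x: "x \<in> carrier A" "n > 0" "x [^]\<^bsub>A\<^esub> n = \<one>\<^bsub>A\<^esub>"
      by (auto simp: torsion_def)
    then show "inv\<^bsub>A\<^esub> x \<in> torsion A" by (auto simp: torsion_def nat_pow_inv)
    fix y assume "y \<in> torsion A"
    then obtain m :: nat where y: "y \<in> carrier A" "m > 0" "y [^]\<^bsub>A\<^esub> m = \<one>\<^bsub>A\<^esub>"
      by (auto simp: torsion_def)
    have "(x \<otimes>\<^bsub>A\<^esub> y) [^]\<^bsub>A\<^esub> (n * m) = (x [^]\<^bsub>A\<^esub> n) [^]\<^bsub>A\<^esub> m \<otimes>\<^bsub>A\<^esub> (y [^]\<^bsub>A\<^esub> m) [^]\<^bsub>A\<^esub> n"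
      using x(1) y(1) by (simp add: nat_pow_distrib nat_pow_pow mult.commute[of n m])
    then have "(x \<otimes>\<^bsub>A\<^esub> y) [^]\<^bsub>A\<^esub> (n * m) = \<one>\<^bsub>A\<^esub>" by (simp add: x y)
    then show "x \<otimes>\<^bsub>A\<^esub> y \<in> torsion A"
      using x y by (auto simp: torsion_def intro!: exI[of _ "n * m"])
  qed (auto simp: torsion_def)
qed

lemma torsion_if_pow_torsion:
  assumes "group A" "x \<in> carrier A" "(n::nat) > 0" "x [^]\<^bsub>A\<^esub> n \<in> torsion A"
  shows "x \<in> torsion A"
proof -
  interpret group A by fact
  from assms obtain m :: nat where "m > 0" "(x [^]\<^bsub>A\<^esub> n) [^]\<^bsub>A\<^esub> m = \<one>\<^bsub>A\<^esub>"
    by (auto simp: torsion_def)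
  then show ?thesis using assms
    by (auto simp: torsion_def nat_pow_pow intro!: exI[of _ "n * m"])
qed

lemma hom_torsion:
  assumes "group A" "group B" "f \<in> hom A B" "x \<in> torsion A"
  shows "f x \<in> torsion B"
proof -
  interpret group_hom A B f using assms(1-3) by (rule group_homI)
  from assms(4) obtain n :: nat where n: "x \<in> carrier A" "n > 0" "x [^]\<^bsub>A\<^esub> n = \<one>\<^bsub>A\<^esub>"
    by (auto simp: torsion_def)
  then have "f x [^]\<^bsub>B\<^esub> n = \<one>\<^bsub>B\<^esub>" using hom_nat_pow[of x n] by simp
  with n show ?thesis by (auto simp: torsion_def)
qed

lemma hom_Tors:
  assumes "group A" "group B" "f \<in> hom A B"
  shows "f \<in> hom (Tors A) (Tors B)"
  using hom_torsion[OF assms] hom_mult[OF assms(3)]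
  by (auto simp: hom_def Tors_def torsion_def)

lemma group_Tors: "comm_group A \<Longrightarrow> group (Tors A)"
  unfolding Tors_def
  by (intro subgroup.subgroup_is_group torsion_subgroup comm_group_is_group)

lemma kernel_Tors: "kernel (Tors A) (Tors B) f = {x \<in> torsion A. f x = \<one>\<^bsub>B\<^esub>}"
  by (simp add: kernel_def Tors_def)

lemma comm_group_tors_free: "comm_group A \<Longrightarrow> comm_group (tors_free A)"
  unfolding tors_free_def by (intro comm_group.abelian_FactGroup torsion_subgroup)

lemma tors_free_proj_hom: "comm_group A \<Longrightarrow> tors_free_proj A \<in> hom A (tors_free A)"
  unfolding tors_free_def tors_free_proj_def [abs_def] by (intro r_coset_hom torsion_subgroup)

lemma carrier_tors_free: "carrier (tors_free A) = tors_free_proj A ` carrier A"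
  by (simp add: tors_free_def tors_free_proj_def [abs_def] carrier_FactGroup)

lemma tors_free_proj_eq_one_iff:
  assumes "comm_group A" "x \<in> carrier A"
  shows "tors_free_proj A x = \<one>\<^bsub>tors_free A\<^esub> \<longleftrightarrow> x \<in> torsion A"
  using assms by (simp add: tors_free_def tors_free_proj_def r_coset_eq_subgroup_iff
      comm_group_is_group torsion_subgroup)

text \<open>If \<open>n x\<close> is torsion, then so is \<open>x\<close>.\<close>

lemma torsion_tors_free:
  assumes "comm_group A"
  shows "torsion (tors_free A) = {\<one>\<^bsub>tors_free A\<^esub>}"
proof -
  interpret A: comm_group A by fact
  interpret T: comm_group "tors_free A" using assms by (rule comm_group_tors_free)
  interpret group_hom A "tors_free A" "tors_free_proj A"
    using assms by (intro group_homI A.is_group T.is_group tors_free_proj_hom)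
  have "tors_free_proj A x = \<one>\<^bsub>tors_free A\<^esub>"
    if x: "x \<in> carrier A" "tors_free_proj A x \<in> torsion (tors_free A)" for x
  proof -
    from x obtain n :: nat where "n > 0" "tors_free_proj A (x [^]\<^bsub>A\<^esub> n) = \<one>\<^bsub>tors_free A\<^esub>"
      by (auto simp: torsion_def hom_nat_pow)
    then have "x \<in> torsion A"
      using torsion_if_pow_torsion[OF A.is_group x(1)] x(1)
      by (simp add: tors_free_proj_eq_one_iff[OF assms])
    then show ?thesis using x(1) by (simp add: tors_free_proj_eq_one_iff[OF assms])
  qed
  moreover have "torsion (tors_free A) \<subseteq> tors_free_proj A ` carrier A"
    by (auto simp: torsion_def carrier_tors_free)
  moreover have "\<one>\<^bsub>tors_free A\<^esub> \<in> torsion (tors_free A)"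
    by (rule subgroup.one_closed[OF torsion_subgroup[OF T.comm_group_axioms]])
  ultimately show ?thesis by blast
qed


section \<open>Tensor products\<close>

lemma tensor_rel_subgroup:
  assumes "group A" "group B"
  shows "subgroup (tensor_rel A B) (free_Abelian_group (carrier A \<times> carrier B))"
proof -
  interpret A: group A by fact
  interpret B: group B by fact
  show ?thesis
    unfolding tensor_rel_def
    by (rule group.generate_is_subgroup) (auto dest!: subsetD[OF keys_diff])
qed

lemma comm_group_tensor: "group A \<Longrightarrow> group B \<Longrightarrow> comm_group (tensor A B)"
  unfolding tensor_def
  by (intro comm_group.abelian_FactGroup abelian_free_Abelian_group tensor_rel_subgroup)

lemma pure_tensor_closed:
  assumes "a \<in> carrier A" "b \<in> carrier B"
  shows "pure_tensor A B a b \<in> carrier (tensor A B)"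
  using assms by (auto simp: pure_tensor_def tensor_def carrier_FactGroup)

lemma tensor_coset_hom:
  assumes "group A" "group B"
  shows "(\<lambda>x. tensor_rel A B #>\<^bsub>free_Abelian_group (carrier A \<times> carrier B)\<^esub> x)
          \<in> hom (free_Abelian_group (carrier A \<times> carrier B)) (tensor A B)"
  unfolding tensor_def by (intro r_coset_hom abelian_free_Abelian_group tensor_rel_subgroup assms)

lemma pure_tensor_eq_one_iff:
  assumes "group A" "group B" "a \<in> carrier A" "b \<in> carrier B"
  shows "pure_tensor A B a b = \<one>\<^bsub>tensor A B\<^esub> \<longleftrightarrow> frag_of (a, b) \<in> tensor_rel A B"
  using assms unfolding pure_tensor_def tensor_def one_FactGroup
  by (intro r_coset_eq_subgroup_iff tensor_rel_subgroup) auto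

lemma pure_tensor_mult_left:
  assumes "group A" "group B" "a \<in> carrier A" "a' \<in> carrier A" "b \<in> carrier B"
  shows "pure_tensor A B (a \<otimes>\<^bsub>A\<^esub> a') b = pure_tensor A B a b \<otimes>\<^bsub>tensor A B\<^esub> pure_tensor A B a' b"
proof -
  interpret A: group A by fact
  let ?F = "free_Abelian_group (carrier A \<times> carrier B)"
  have k: "Poly_Mapping.keys (frag_of (a, b) + frag_of (a', b)) \<subseteq> carrier A \<times> carrier B"
    using assms by (auto dest!: subsetD[OF keys_add])
  have "frag_of (a \<otimes>\<^bsub>A\<^esub> a', b) - frag_of (a, b) - frag_of (a', b) \<in> tensor_rel A B"
    unfolding tensor_rel_def using assms by (intro generate.incl) blast
  then have "tensor_rel A B #>\<^bsub>?F\<^esub> frag_of (a \<otimes>\<^bsub>A\<^esub> a', b)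
      = tensor_rel A B #>\<^bsub>?F\<^esub> (frag_of (a, b) \<otimes>\<^bsub>?F\<^esub> frag_of (a', b))"
    using assms k by (subst r_coset_eq_iff[OF _ tensor_rel_subgroup]) (auto simp: algebra_simps)
  also have "\<dots> = pure_tensor A B a b \<otimes>\<^bsub>tensor A B\<^esub> pure_tensor A B a' b"
    unfolding pure_tensor_def using assms by (subst hom_mult[OF tensor_coset_hom]) auto
  finally show ?thesis by (simp add: pure_tensor_def)
qed

lemma pure_tensor_mult_right:
  assumes "group A" "group B" "a \<in> carrier A" "b \<in> carrier B" "b' \<in> carrier B"
  shows "pure_tensor A B a (b \<otimes>\<^bsub>B\<^esub> b') = pure_tensor A B a b \<otimes>\<^bsub>tensor A B\<^esub> pure_tensor A B a b'"
proof -
  interpret B: group B by fact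
  let ?F = "free_Abelian_group (carrier A \<times> carrier B)"
  have k: "Poly_Mapping.keys (frag_of (a, b) + frag_of (a, b')) \<subseteq> carrier A \<times> carrier B"
    using assms by (auto dest!: subsetD[OF keys_add])
  have "frag_of (a, b \<otimes>\<^bsub>B\<^esub> b') - frag_of (a, b) - frag_of (a, b') \<in> tensor_rel A B"
    unfolding tensor_rel_def using assms by (intro generate.incl) blast
  then have "tensor_rel A B #>\<^bsub>?F\<^esub> frag_of (a, b \<otimes>\<^bsub>B\<^esub> b')
      = tensor_rel A B #>\<^bsub>?F\<^esub> (frag_of (a, b) \<otimes>\<^bsub>?F\<^esub> frag_of (a, b'))"
    using assms k by (subst r_coset_eq_iff[OF _ tensor_rel_subgroup]) (auto simp: algebra_simps)
  also have "\<dots> = pure_tensor A B a b \<otimes>\<^bsub>tensor A B\<^esub> pure_tensor A B a b'"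
    unfolding pure_tensor_def using assms by (subst hom_mult[OF tensor_coset_hom]) auto
  finally show ?thesis by (simp add: pure_tensor_def)
qed

lemma pure_tensor_hom_left:
  assumes "group A" "group B" "b \<in> carrier B"
  shows "(\<lambda>a. pure_tensor A B a b) \<in> hom A (tensor A B)"
  using assms by (intro homI) (auto simp: pure_tensor_closed pure_tensor_mult_left)

lemma pure_tensor_hom_right:
  assumes "group A" "group B" "a \<in> carrier A"
  shows "pure_tensor A B a \<in> hom B (tensor A B)"
  using assms by (intro homI) (auto simp: pure_tensor_closed pure_tensor_mult_right)

text \<open>A free abelian group is generated by its basis under differences, and the basis elements map to
  the pure tensors.\<close>

lemma tensor_induct [consumes 3, case_names pure diff]:
  assumes "group A" "group B" "t \<in> carrier (tensor A B)"
    and pure: "\<And>a b. a \<in> carrier A \<Longrightarrow> b \<in> carrier B \<Longrightarrow> P (pure_tensor A B a b)"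
    and diff: "\<And>s t. s \<in> carrier (tensor A B) \<Longrightarrow> t \<in> carrier (tensor A B) \<Longrightarrow>
                 P s \<Longrightarrow> P t \<Longrightarrow> P (s \<otimes>\<^bsub>tensor A B\<^esub> inv\<^bsub>tensor A B\<^esub> t)"
  shows "P t"
proof -
  let ?F = "free_Abelian_group (carrier A \<times> carrier B)"
  interpret A: group A by fact
  interpret B: group B by fact
  interpret T: comm_group "tensor A B" by (rule comm_group_tensor) fact+
  define c where "c = (\<lambda>x. tensor_rel A B #>\<^bsub>?F\<^esub> x)"
  interpret c: group_hom ?F "tensor A B" c
    unfolding c_def by (intro group_homI tensor_coset_hom assms T.is_group) simp
  have c_diff: "c (x - y) = c x \<otimes>\<^bsub>tensor A B\<^esub> inv\<^bsub>tensor A B\<^esub> c y"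
    if "x \<in> carrier ?F" "y \<in> carrier ?F" for x y
  proof -
    have "c (x \<otimes>\<^bsub>?F\<^esub> inv\<^bsub>?F\<^esub> y) = c x \<otimes>\<^bsub>tensor A B\<^esub> inv\<^bsub>tensor A B\<^esub> c y"
      using that c.G.inv_closed[OF that(2)] by (simp only: c.hom_mult c.hom_inv)
    then show ?thesis using that by simp
  qed
  have "P (c x)" if "Poly_Mapping.keys x \<subseteq> carrier A \<times> carrier B" for x
    using that
  proof (rule free_Abelian_group_induct)
    have "P (pure_tensor A B \<one>\<^bsub>A\<^esub> \<one>\<^bsub>B\<^esub>)" by (rule pure) auto
    from diff[OF _ _ this this] have "P \<one>\<^bsub>tensor A B\<^esub>" by (simp add: pure_tensor_closed)
    then show "P (c 0)" using c.hom_one by simp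
    show "P (c (x - y))" if "Poly_Mapping.keys x \<subseteq> carrier A \<times> carrier B"
      "Poly_Mapping.keys y \<subseteq> carrier A \<times> carrier B" "P (c x)" "P (c y)" for x y
      using that by (subst c_diff) (auto intro!: diff c.hom_closed)
    show "P (c (frag_of a))" if "a \<in> carrier A \<times> carrier B" for a
      using that pure by (auto simp: c_def pure_tensor_def)
  qed
  moreover obtain x where "x \<in> carrier ?F" "t = c x"
    using assms(3) by (auto simp: tensor_def carrier_FactGroup c_def)
  ultimately show ?thesis by simp
qed

text \<open>The map of free abelian groups underlying \<open>f \<otimes> g\<close> sends each bilinearity relation for \<open>A\<close> and \<open>B\<close> to
  one for \<open>A'\<close> and \<open>B'\<close>.\<close>

lemma
  assumes "group A" "group B" "group A'" "group B'" and f: "f \<in> hom A A'" and g: "g \<in> hom B B'"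
  shows tensor_map_hom: "tensor_map A' B' f g \<in> hom (tensor A B) (tensor A' B')"
    and tensor_map_pure: "a \<in> carrier A \<Longrightarrow> b \<in> carrier B \<Longrightarrow>
          tensor_map A' B' f g (pure_tensor A B a b) = pure_tensor A' B' (f a) (g b)"
proof -
  let ?F = "free_Abelian_group (carrier A \<times> carrier B)"
  let ?F' = "free_Abelian_group (carrier A' \<times> carrier B')"
  let ?h = "frag_extend (\<lambda>(a, b). frag_of (f a, g b))"
  interpret A: group A by fact
  interpret B: group B by fact
  have fg: "f a \<in> carrier A'" "g b \<in> carrier B'" if "a \<in> carrier A" "b \<in> carrier B" for a b
    using that f g by (auto simp: hom_def)
  have h: "?h \<in> hom ?F ?F'"
    using fg by (intro homI) (auto simp: frag_extend_add dest!: subsetD[OF keys_frag_extend])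
  have rel: "?h ` tensor_rel A B \<subseteq> tensor_rel A' B'"
    unfolding tensor_rel_def[of A B]
  proof (rule hom_generate_subset[OF _ _ h _ tensor_rel_subgroup[OF assms(3,4)]])
    show "?h ` ({frag_of (a \<otimes>\<^bsub>A\<^esub> a', b) - frag_of (a, b) - frag_of (a', b) | a a' b.
         a \<in> carrier A \<and> a' \<in> carrier A \<and> b \<in> carrier B}
      \<union> {frag_of (a, b \<otimes>\<^bsub>B\<^esub> b') - frag_of (a, b) - frag_of (a, b') | a b b'.
         a \<in> carrier A \<and> b \<in> carrier B \<and> b' \<in> carrier B}) \<subseteq> tensor_rel A' B'"
      unfolding tensor_rel_def
      by (rule subset_trans[OF _ generate_superset])
         (fastforce simp: frag_extend_diff hom_mult[OF f] hom_mult[OF g] fg)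
  qed (auto dest!: subsetD[OF keys_diff])
  note q = abelian_free_Abelian_group abelian_free_Abelian_group
    tensor_rel_subgroup[OF assms(1,2)] tensor_rel_subgroup[OF assms(3,4)] h rel
  show "tensor_map A' B' f g \<in> hom (tensor A B) (tensor A' B')"
    unfolding tensor_map_def tensor_def using q by (rule quot_map_hom)
  show "tensor_map A' B' f g (pure_tensor A B a b) = pure_tensor A' B' (f a) (g b)"
    if "a \<in> carrier A" "b \<in> carrier B"
    unfolding tensor_map_def pure_tensor_def
    using that by (subst quot_map_r_coset[OF _ _ q(3-6)]) auto
qed


section \<open>The tensor product with \<open>\<rat>/\<int>\<close>\<close>

lemma rat_group_simps [simp]:
  "carrier rat_group = UNIV" "x \<otimes>\<^bsub>rat_group\<^esub> y = x + y" "\<one>\<^bsub>rat_group\<^esub> = 0"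
  by (simp_all add: rat_group_def)

lemma comm_group_rat: "comm_group rat_group"
proof (rule comm_groupI)
  fix x show "\<exists>y\<in>carrier rat_group. y \<otimes>\<^bsub>rat_group\<^esub> x = \<one>\<^bsub>rat_group\<^esub>"
    by (auto intro: exI[of _ "- x"])
qed auto

lemma inv_rat_group [simp]: "inv\<^bsub>rat_group\<^esub> x = - x"
  using comm_group_rat by (intro group.inv_equality comm_group_is_group) auto

lemma Ints_subgroup: "subgroup \<int> rat_group"
  using comm_group_rat by (intro group.subgroupI comm_group_is_group) auto

lemma comm_group_QZ: "comm_group QZ"
  unfolding QZ_def by (intro comm_group.abelian_FactGroup comm_group_rat Ints_subgroup)

lemma group_QZ: "group QZ"
  by (rule comm_group_is_group) (rule comm_group_QZ)

lemma QZ_class_hom: "QZ_class \<in> hom rat_group QZ"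
  unfolding QZ_class_def [abs_def] QZ_def by (intro r_coset_hom comm_group_rat Ints_subgroup)

lemma carrier_QZ: "carrier QZ = range QZ_class"
  by (simp add: QZ_def QZ_class_def [abs_def] carrier_FactGroup)

lemma QZ_class_closed [simp]: "QZ_class q \<in> carrier QZ"
  by (simp add: carrier_QZ)

lemma QZ_class_add: "QZ_class (p + q) = QZ_class p \<otimes>\<^bsub>QZ\<^esub> QZ_class q"
  using hom_mult[OF QZ_class_hom] by simp

lemma QZ_class_of_int [simp]: "QZ_class (of_int k) = \<one>\<^bsub>QZ\<^esub>"
  unfolding QZ_class_def QZ_def one_FactGroup
  by (simp add: r_coset_eq_subgroup_iff comm_group_rat comm_group_is_group Ints_subgroup)

lemma QZ_class_pow: "QZ_class q [^]\<^bsub>QZ\<^esub> (n::nat) = QZ_class (of_nat n * q)"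
proof (induction n)
  case 0
  show ?case using QZ_class_of_int[of 0] by simp
next
  case (Suc n)
  then show ?case by (simp add: QZ_class_add[symmetric] algebra_simps)
qed

lemma QZ_class_int_pow: "QZ_class q [^]\<^bsub>QZ\<^esub> (k::int) = QZ_class (of_int k * q)"
proof -
  interpret c: group_hom rat_group QZ QZ_class
    by (intro group_homI comm_group_is_group comm_group_rat comm_group_QZ QZ_class_hom)
  show ?thesis
  proof (cases k rule: int_cases2)
    case (nonneg n)
    then show ?thesis by (simp add: int_pow_int QZ_class_pow)
  next
    case (nonpos n)
    have "QZ_class (- (of_nat n * q)) = inv\<^bsub>QZ\<^esub> QZ_class (of_nat n * q)"
      using c.hom_inv[of "of_nat n * q"] by simp
    then show ?thesis using nonpos by (simp add: c.H.int_pow_neg_int QZ_class_pow)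
  qed
qed

definition frac_tensor :: "('a, 'm) monoid_scheme \<Rightarrow> nat \<Rightarrow> 'a \<Rightarrow> (rat set \<times> 'a \<Rightarrow>\<^sub>0 int) set" where
  "frac_tensor A n z = pure_tensor QZ A (QZ_class (1 / of_nat n)) z"

text \<open>In additive notation, the subgroup \<open>n A + A\<^sub>T\<^sub>o\<^sub>r\<^sub>s\<close>.\<close>

definition divisible_mod_torsion :: "('a, 'm) monoid_scheme \<Rightarrow> nat \<Rightarrow> 'a set" where
  "divisible_mod_torsion A n = {c [^]\<^bsub>A\<^esub> n \<otimes>\<^bsub>A\<^esub> t | c t. c \<in> carrier A \<and> t \<in> torsion A}"

text \<open>For \<open>q = r + \<int>\<close> with \<open>N r\<close> an integer, this is \<open>N r\<close> up to a multiple of \<open>N\<close>, whichever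
  representative is chosen. The floor gives every class a value, so that no restriction to the
  classes with denominator dividing \<open>N\<close> is needed when the function is used on all of \<open>\<rat>/\<int>\<close>.\<close>

definition scaled_numerator :: "nat \<Rightarrow> rat set \<Rightarrow> int" where
  "scaled_numerator N q = \<lfloor>of_nat N * (SOME r. r \<in> q)\<rfloor>"

lemma scaled_numerator_QZ_class:
  assumes "of_nat N * r = of_int m"
  obtains k :: int where "scaled_numerator N (QZ_class r) = m + int N * k"
proof -
  have "r \<in> QZ_class r"
    by (auto simp: QZ_class_def r_coset_def intro!: bexI[of _ 0])
  then have "(SOME s. s \<in> QZ_class r) \<in> QZ_class r" by (rule someI)
  then obtain k where k: "(SOME s. s \<in> QZ_class r) = of_int k + r"
    by (auto simp: QZ_class_def r_coset_def elim!: Ints_cases)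
  have "of_nat N * (of_int k + r) = (of_int (m + int N * k) :: rat)"
    using assms by (simp add: algebra_simps)
  then have "scaled_numerator N (QZ_class r) = m + int N * k"
    unfolding scaled_numerator_def k by (simp only: floor_of_int)
  then show ?thesis by (rule that)
qed

lemma common_denominator:
  fixes r :: rat
  shows "\<exists>d::nat. d > 0 \<and> (\<forall>N. d dvd N \<longrightarrow> (\<exists>m::int. of_nat N * r = of_int m))"
proof -
  obtain a b where ab: "quotient_of r = (a, b)" by force
  then have b: "b > 0" "r = of_int a / of_int b"
    by (auto intro: quotient_of_denom_pos quotient_of_div)
  have "\<exists>m::int. of_nat N * r = of_int m" if "nat b dvd N" for N
  proof -
    from that obtain l where "N = nat b * l" by (rule dvdE)
    then have "of_nat N * r = of_int (int l * a)" using b by simp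
    then show ?thesis by blast
  qed
  with b(1) show ?thesis by (intro exI[of _ "nat b"]) auto
qed

context comm_group
begin

lemma divisible_mod_torsionI:
  "c \<in> carrier G \<Longrightarrow> t \<in> torsion G \<Longrightarrow> c [^] n \<otimes> t \<in> divisible_mod_torsion G n"
  unfolding divisible_mod_torsion_def by blast

lemma divisible_mod_torsionE:
  assumes "x \<in> divisible_mod_torsion G n"
  obtains c t where "x = c [^] n \<otimes> t" "c \<in> carrier G" "t \<in> torsion G" "t \<in> carrier G"
  using assms unfolding divisible_mod_torsion_def torsion_def by blast

lemma divisible_mod_torsion_subgroup: "subgroup (divisible_mod_torsion G n) G"
proof -
  interpret T: subgroup "torsion G" G by (rule torsion_subgroup) (rule comm_group_axioms)
  show ?thesis
  proof (rule subgroupI)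
    show "divisible_mod_torsion G n \<subseteq> carrier G" by (auto elim!: divisible_mod_torsionE)
    show "divisible_mod_torsion G n \<noteq> {}"
      using divisible_mod_torsionI[OF one_closed T.one_closed] by blast
    fix x assume "x \<in> divisible_mod_torsion G n"
    then obtain c t where x: "x = c [^] n \<otimes> t" "c \<in> carrier G" "t \<in> torsion G" "t \<in> carrier G"
      by (rule divisible_mod_torsionE)
    then have "inv x = (inv c) [^] n \<otimes> inv t" by (simp add: inv_mult nat_pow_inv)
    then show "inv x \<in> divisible_mod_torsion G n"
      using divisible_mod_torsionI[of "inv c" "inv t"] x by simp
    fix y assume "y \<in> divisible_mod_torsion G n"
    then obtain d s where y: "y = d [^] n \<otimes> s" "d \<in> carrier G" "s \<in> torsion G" "s \<in> carrier G"
      by (rule divisible_mod_torsionE)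
    have "x \<otimes> y = (c \<otimes> d) [^] n \<otimes> (t \<otimes> s)"
      using x y by (simp add: nat_pow_distrib m_ac)
    then show "x \<otimes> y \<in> divisible_mod_torsion G n"
      using divisible_mod_torsionI[of "c \<otimes> d" "t \<otimes> s"] x y by simp
  qed
qed

lemma int_pow_multiple_in_divisible:
  assumes "b \<in> carrier G" shows "b [^] (int n * k) \<in> divisible_mod_torsion G n"
proof -
  have "b [^] (int n * k) = (b [^] k) [^] n \<otimes> \<one>"
    using int_pow_pow[OF assms, of k "int n"] assms by (simp add: int_pow_int mult.commute[of k])
  moreover have "\<one> \<in> torsion G"
    by (rule subgroup.one_closed[OF torsion_subgroup[OF comm_group_axioms]])
  ultimately show ?thesis using divisible_mod_torsionI[of "b [^] k" \<one>] assms by simp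
qed

text \<open>If \<open>k z = n k c + t\<close> with \<open>t\<close> torsion, then \<open>u = z - n c\<close> satisfies \<open>k u = t\<close> and is therefore torsion.\<close>

lemma divisible_mod_torsion_cancel:
  assumes "z \<in> carrier G" "(k::nat) > 0" "z [^] k \<in> divisible_mod_torsion G (n * k)"
  shows "z \<in> divisible_mod_torsion G n"
proof -
  from assms(3) obtain c t
    where c: "z [^] k = c [^] (n * k) \<otimes> t" "c \<in> carrier G" "t \<in> torsion G" and t: "t \<in> carrier G"
    by (rule divisible_mod_torsionE)
  define u where "u = z \<otimes> inv (c [^] n)"
  have u: "u \<in> carrier G" using assms c by (simp add: u_def)
  have zu: "z = c [^] n \<otimes> u"
    using assms c by (simp add: u_def m_lcomm)
  have "c [^] (n * k) \<otimes> u [^] k = c [^] (n * k) \<otimes> t"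
    unfolding c(1)[symmetric] using c u by (simp add: zu nat_pow_distrib nat_pow_pow)
  then have "u [^] k = t" using c t u by simp
  then have "u \<in> torsion G"
    using torsion_if_pow_torsion[OF is_group u assms(2)] c by simp
  then show ?thesis using divisible_mod_torsionI[OF c(2)] zu by simp
qed

text \<open>The map \<open>h N\<close> is the extension of \<open>(q, a) \<mapsto> (N q) a\<close> to formal sums. Modulo \<open>N A\<close> it is additive in
  \<open>q\<close> only where \<open>N\<close> clears the denominators. Therefore the formal sums that are killed for all
  sufficiently divisible \<open>N\<close> are considered: they form a subgroup, since the bounds \<open>M\<close> of two of them can be multiplied,
  and this subgroup contains all bilinearity relations. Demanding this for all multiples of \<open>M\<close> is what replaces
  the construction of a target group for a single bilinear map on \<open>\<rat>/\<int> \<times> A\<close>.\<close>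

lemma tensor_rel_numerators_divisible:
  fixes h :: "nat \<Rightarrow> (rat set \<times> 'a \<Rightarrow>\<^sub>0 int) \<Rightarrow> 'a"
  assumes h: "\<And>N. h N \<in> hom (free_Abelian_group (carrier QZ \<times> carrier G)) G"
    and h_of: "\<And>N q a. q \<in> carrier QZ \<Longrightarrow> a \<in> carrier G \<Longrightarrow>
                 h N (frag_of (q, a)) = a [^] scaled_numerator N q"
    and x: "x \<in> tensor_rel QZ G"
  shows "\<exists>M>0. \<forall>N>0. M dvd N \<longrightarrow> h N x \<in> divisible_mod_torsion G N"
proof -
  let ?F = "free_Abelian_group (carrier QZ \<times> carrier G)"
  let ?T = "{x \<in> carrier ?F. \<exists>M>0. \<forall>N>0. M dvd N \<longrightarrow> h N x \<in> divisible_mod_torsion G N}"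
  interpret F: comm_group ?F by (rule abelian_free_Abelian_group)
  interpret Q: comm_group QZ by (rule comm_group_QZ)
  interpret h: group_hom ?F G "h N" for N using h by (intro group_homI) auto
  interpret D: subgroup "divisible_mod_torsion G N" G for N by (rule divisible_mod_torsion_subgroup)
  have sub: "subgroup ?T ?F"
  proof (rule F.subgroupI)
    have "\<one>\<^bsub>?F\<^esub> \<in> ?T"
      using h.hom_one by (auto intro!: exI[of _ "1::nat"])
    then show "?T \<noteq> {}" by blast
    fix x assume x: "x \<in> ?T"
    then show "inv\<^bsub>?F\<^esub> x \<in> ?T"
      using F.inv_closed by (auto simp del: inv_free_Abelian_group carrier_free_Abelian_group_iff)
    fix y assume y: "y \<in> ?T"
    from x obtain M where M: "M > 0" "\<And>N. N > 0 \<Longrightarrow> M dvd N \<Longrightarrow> h N x \<in> divisible_mod_torsion G N"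
      by blast
    from y obtain K where K: "K > 0" "\<And>N. N > 0 \<Longrightarrow> K dvd N \<Longrightarrow> h N y \<in> divisible_mod_torsion G N"
      by blast
    have "h N (x \<otimes>\<^bsub>?F\<^esub> y) \<in> divisible_mod_torsion G N" if "N > 0" "M * K dvd N" for N
    proof -
      have "M dvd N" "K dvd N" using that(2) by (auto dest: dvd_mult_left dvd_mult_right)
      then show ?thesis using x y M K that
        by (simp del: mult_free_Abelian_group carrier_free_Abelian_group_iff)
    qed
    moreover have "x \<otimes>\<^bsub>?F\<^esub> y \<in> carrier ?F" using x y by (intro F.m_closed) auto
    moreover have "M * K > 0" using M K by simp
    ultimately show "x \<otimes>\<^bsub>?F\<^esub> y \<in> ?T" by blast
  qed auto
  have diff: "h N (frag_of p - frag_of q - frag_of r) = h N (frag_of p) \<otimes> inv (h N (frag_of q)) \<otimes> inv (h N (frag_of r))"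
    and diff_in: "frag_of p - frag_of q - frag_of r \<in> carrier ?F"
    if "p \<in> carrier QZ \<times> carrier G" "q \<in> carrier QZ \<times> carrier G" "r \<in> carrier QZ \<times> carrier G" for p q r N
  proof -
    have eq: "frag_of p - frag_of q - frag_of r = frag_of p \<otimes>\<^bsub>?F\<^esub> inv\<^bsub>?F\<^esub> (frag_of q) \<otimes>\<^bsub>?F\<^esub> inv\<^bsub>?F\<^esub> (frag_of r)"
      using that by simp
    have c: "frag_of p \<in> carrier ?F" "frag_of q \<in> carrier ?F" "frag_of r \<in> carrier ?F"
      using that by (simp_all only: frag_of_in_free_Abelian_group)
    show "h N (frag_of p - frag_of q - frag_of r) = h N (frag_of p) \<otimes> inv (h N (frag_of q)) \<otimes> inv (h N (frag_of r))"
      unfolding eq using c by (simp only: h.hom_mult h.hom_inv F.inv_closed F.m_closed)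
    show "frag_of p - frag_of q - frag_of r \<in> carrier ?F"
      unfolding eq using c by (intro F.inv_closed F.m_closed)
  qed
  have left: "frag_of (q \<otimes>\<^bsub>QZ\<^esub> q', b) - frag_of (q, b) - frag_of (q', b) \<in> ?T"
    if q: "q \<in> carrier QZ" "q' \<in> carrier QZ" and b: "b \<in> carrier G" for q q' b
  proof -
    from q obtain r r' where r: "q = QZ_class r" "q' = QZ_class r'" by (auto simp: carrier_QZ)
    obtain d where d: "d > 0" "\<And>N. d dvd N \<Longrightarrow> \<exists>m::int. of_nat N * r = of_int m"
      using common_denominator[of r] by blast
    obtain e where e: "e > 0" "\<And>N. e dvd N \<Longrightarrow> \<exists>m::int. of_nat N * r' = of_int m"
      using common_denominator[of r'] by blast
    \<comment> \<open>The product of a denominator of q and one of q' serves as the bound.\<close>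
    have "h N (frag_of (q \<otimes>\<^bsub>QZ\<^esub> q', b) - frag_of (q, b) - frag_of (q', b)) \<in> divisible_mod_torsion G N"
      if "N > 0" "d * e dvd N" for N
    proof -
      have "d dvd N" "e dvd N" using that(2) by (auto dest: dvd_mult_left dvd_mult_right)
      with d e obtain m m' :: int where m: "of_nat N * r = of_int m" "of_nat N * r' = of_int m'"
        by blast
      then have m'': "of_nat N * (r + r') = of_int (m + m')" by (simp add: algebra_simps)
      obtain k where k: "scaled_numerator N q = m + int N * k"
        unfolding r by (rule scaled_numerator_QZ_class[OF m(1)])
      obtain k' where k': "scaled_numerator N q' = m' + int N * k'"
        unfolding r by (rule scaled_numerator_QZ_class[OF m(2)])
      obtain k'' where k'': "scaled_numerator N (q \<otimes>\<^bsub>QZ\<^esub> q') = m + m' + int N * k''"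
        unfolding r QZ_class_add[symmetric] by (rule scaled_numerator_QZ_class[OF m''])
      have "h N (frag_of (q \<otimes>\<^bsub>QZ\<^esub> q', b) - frag_of (q, b) - frag_of (q', b))
          = b [^] (m + m' + int N * k'') \<otimes> inv (b [^] (m + int N * k)) \<otimes> inv (b [^] (m' + int N * k'))"
        using q b by (subst diff) (simp_all add: h_of k k' k'')
      also have "\<dots> = b [^] (int N * (k'' - k - k'))"
        unfolding int_pow_diff[OF b, symmetric] by (rule arg_cong[where f = "\<lambda>e. b [^] e"]) (simp add: algebra_simps)
      finally show ?thesis using int_pow_multiple_in_divisible[OF b] by simp
    qed
    moreover have "d * e > 0" using d e by simp
    moreover have "frag_of (q \<otimes>\<^bsub>QZ\<^esub> q', b) - frag_of (q, b) - frag_of (q', b) \<in> carrier ?F"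
      using q b by (intro diff_in) auto
    ultimately show ?thesis by blast
  qed
  have right: "frag_of (q, b \<otimes> b') - frag_of (q, b) - frag_of (q, b') \<in> ?T"
    if q: "q \<in> carrier QZ" and b: "b \<in> carrier G" "b' \<in> carrier G" for q b b'
  proof -
    have "h N (frag_of (q, b \<otimes> b') - frag_of (q, b) - frag_of (q, b')) = \<one>" for N
    proof -
      have "x \<otimes> y \<otimes> inv x \<otimes> inv y = \<one>" if "x \<in> carrier G" "y \<in> carrier G" for x y
        using that r_inv[of "x \<otimes> y"] by (simp add: inv_mult m_assoc)
      then show ?thesis using q b by (subst diff) (simp_all add: h_of int_pow_distrib)
    qed
    moreover have "frag_of (q, b \<otimes> b') - frag_of (q, b) - frag_of (q, b') \<in> carrier ?F"
      using q b by (intro diff_in) auto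
    ultimately show ?thesis using D.one_closed by (intro CollectI conjI exI[of _ "1::nat"]) simp_all
  qed
  have "tensor_rel QZ G \<subseteq> ?T"
    unfolding tensor_rel_def
    by (rule F.generate_subgroup_incl[OF subsetI sub]; elim UnE CollectE exE conjE) (simp_all only: left right)
  then show ?thesis using x by blast
qed

lemma frac_tensor_closed: "z \<in> carrier G \<Longrightarrow> frac_tensor G n z \<in> carrier (tensor QZ G)"
  unfolding frac_tensor_def by (intro pure_tensor_closed) auto

lemma frac_tensor_hom: "frac_tensor G n \<in> hom G (tensor QZ G)"
  unfolding frac_tensor_def [abs_def] using group_QZ is_group
  by (intro pure_tensor_hom_right) auto

lemma comm_group_QZ_tensor: "comm_group (tensor QZ G)"
  using group_QZ is_group by (intro comm_group_tensor) auto

lemma frac_tensor_group_hom: "group_hom G (tensor QZ G) (frac_tensor G n)"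
  by (intro group_homI frac_tensor_hom comm_group_is_group comm_group_QZ_tensor is_group)

text \<open>An integer factor can be moved across the tensor sign; so \<open>1/n \<otimes> z\<close> can be expanded to denominator \<open>n k\<close>,
  and all arithmetic below is done with common denominators.\<close>

lemma pure_tensor_QZ_int_pow:
  assumes z: "z \<in> carrier G"
  shows "pure_tensor QZ G (QZ_class q) (z [^] (k::int)) = pure_tensor QZ G (QZ_class (of_int k * q)) z"
proof -
  interpret T: comm_group "tensor QZ G" by (rule comm_group_QZ_tensor)
  interpret R: group_hom G "tensor QZ G" "pure_tensor QZ G (QZ_class q)"
    by (intro group_homI pure_tensor_hom_right group_QZ T.is_group is_group) auto
  interpret L: group_hom QZ "tensor QZ G" "\<lambda>a. pure_tensor QZ G a z"
    by (intro group_homI pure_tensor_hom_left group_QZ T.is_group is_group z)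
  have "pure_tensor QZ G (QZ_class q) (z [^] k) = pure_tensor QZ G (QZ_class q) z [^]\<^bsub>tensor QZ G\<^esub> k"
    using z by (rule R.hom_int_pow)
  also have "\<dots> = pure_tensor QZ G (QZ_class q [^]\<^bsub>QZ\<^esub> k) z"
    by (rule L.hom_int_pow[symmetric]) simp
  finally show ?thesis by (simp only: QZ_class_int_pow)
qed

lemma frac_tensor_expand:
  assumes z: "z \<in> carrier G" and "k > 0"
  shows "frac_tensor G (n * k) (z [^] k) = frac_tensor G n z"
  using pure_tensor_QZ_int_pow[OF z, of "1 / of_nat (n * k)" "int k"] assms
  by (simp add: frac_tensor_def int_pow_int)

text \<open>Since \<open>\<rat>/\<int>\<close> is divisible: if \<open>m t = 0\<close>, then \<open>1/n \<otimes> t = 1/(n m) \<otimes> m t = 0\<close>.\<close>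

lemma frac_tensor_torsion:
  assumes "t \<in> torsion G" shows "frac_tensor G n t = \<one>\<^bsub>tensor QZ G\<^esub>"
proof -
  from assms obtain m :: nat where m: "t \<in> carrier G" "m > 0" "t [^] m = \<one>"
    by (auto simp: torsion_def)
  interpret f: group_hom G "tensor QZ G" "frac_tensor G k" for k by (rule frac_tensor_group_hom)
  show ?thesis using frac_tensor_expand[OF m(1,2), of n] unfolding m(3) by (simp only: f.hom_one)
qed

lemma frac_tensor_pow:
  assumes "c \<in> carrier G" "n > 0" shows "frac_tensor G n (c [^] n) = \<one>\<^bsub>tensor QZ G\<^esub>"
proof -
  interpret L: group_hom QZ "tensor QZ G" "\<lambda>a. pure_tensor QZ G a c"
    by (intro group_homI pure_tensor_hom_left group_QZ is_group assms
        comm_group_is_group comm_group_QZ_tensor)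
  have "frac_tensor G n (c [^] n) = frac_tensor G 1 c"
    using frac_tensor_expand[OF assms, of 1] by simp
  also have "\<dots> = \<one>\<^bsub>tensor QZ G\<^esub>"
    using L.hom_one QZ_class_of_int[of 1] unfolding frac_tensor_def by simp
  finally show ?thesis .
qed

text \<open>The key fact on \<open>\<rat>/\<int> \<otimes> A\<close>. If \<open>1/n \<otimes> z = 0\<close>, then the formal sum consisting of the one pair
  \<open>(1/n, z)\<close> is a combination of bilinearity relations, so \<open>(N/n) z \<in> N A + A\<^sub>T\<^sub>o\<^sub>r\<^sub>s\<close> for every multiple
  \<open>N\<close> of some \<open>M\<close>. Taking \<open>N = n M\<close> and cancelling \<open>M\<close> gives the claim.\<close>

lemma frac_tensor_eq_one_iff:
  assumes z: "z \<in> carrier G" and n: "n > 0"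
  shows "frac_tensor G n z = \<one>\<^bsub>tensor QZ G\<^esub> \<longleftrightarrow> z \<in> divisible_mod_torsion G n"
proof
  interpret f: group_hom G "tensor QZ G" "frac_tensor G n" by (rule frac_tensor_group_hom)
  assume "z \<in> divisible_mod_torsion G n"
  then obtain c t where c: "z = c [^] n \<otimes> t" "c \<in> carrier G" "t \<in> torsion G"
    by (auto simp: divisible_mod_torsion_def)
  then have "t \<in> carrier G" by (simp add: torsion_def)
  have "frac_tensor G n z = frac_tensor G n (c [^] n) \<otimes>\<^bsub>tensor QZ G\<^esub> frac_tensor G n t"
    unfolding c(1) using c \<open>t \<in> carrier G\<close> by (intro f.hom_mult) auto
  then show "frac_tensor G n z = \<one>\<^bsub>tensor QZ G\<^esub>"
    using c n by (simp only: frac_tensor_pow frac_tensor_torsion f.H.l_one f.H.one_closed)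
next
  let ?F = "free_Abelian_group (carrier QZ \<times> carrier G)"
  assume "frac_tensor G n z = \<one>\<^bsub>tensor QZ G\<^esub>"
  then have rel: "frag_of (QZ_class (1 / of_nat n), z) \<in> tensor_rel QZ G"
    unfolding frac_tensor_def using z group_QZ
    by (subst (asm) pure_tensor_eq_one_iff) auto
  have "\<exists>f. f \<in> hom ?F G \<and> (\<forall>q\<in>carrier QZ. \<forall>a\<in>carrier G. f (frag_of (q, a)) = a [^] scaled_numerator N q)" for N
    by (rule free_Abelian_group_universal[of "\<lambda>(q, a). a [^] scaled_numerator N q" "carrier QZ \<times> carrier G"])
       fastforce+
  then obtain h where h: "\<And>N. h N \<in> hom ?F G"
      "\<And>N q a. q \<in> carrier QZ \<Longrightarrow> a \<in> carrier G \<Longrightarrow> h N (frag_of (q, a)) = a [^] scaled_numerator N q"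
    by metis
  obtain M where M: "M > 0" "\<And>N. N > 0 \<Longrightarrow> M dvd N \<Longrightarrow>
      h N (frag_of (QZ_class (1 / of_nat n), z)) \<in> divisible_mod_torsion G N"
    using tensor_rel_numerators_divisible[OF h rel] by blast
  have nM: "n * M > 0" using n M by simp
  have "of_nat (n * M) * (1 / of_nat n) = (of_int (int M) :: rat)" using n by simp
  then obtain k where k: "scaled_numerator (n * M) (QZ_class (1 / of_nat n)) = int M + int (n * M) * k"
    by (rule scaled_numerator_QZ_class)
  interpret D: subgroup "divisible_mod_torsion G (n * M)" G by (rule divisible_mod_torsion_subgroup)
  have *: "z [^] int M \<otimes> z [^] (int (n * M) * k) \<in> divisible_mod_torsion G (n * M)"
    using M(2)[OF nM] z by (simp add: h k int_pow_mult del: of_nat_mult)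
  have "z [^] int M = z [^] int M \<otimes> z [^] (int (n * M) * k) \<otimes> inv (z [^] (int (n * M) * k))"
    using z by (simp add: m_assoc del: of_nat_mult)
  also have "\<dots> \<in> divisible_mod_torsion G (n * M)"
    by (rule D.m_closed[OF * D.m_inv_closed[OF int_pow_multiple_in_divisible[OF z]]])
  finally show "z \<in> divisible_mod_torsion G n"
    using divisible_mod_torsion_cancel[OF z M(1)] by (simp add: int_pow_int)
qed

lemma frac_tensor_mult:
  assumes "x \<in> carrier G" "y \<in> carrier G" "n > 0" "m > 0"
  shows "frac_tensor G n x \<otimes>\<^bsub>tensor QZ G\<^esub> frac_tensor G m y
     = frac_tensor G (n * m) (x [^] m \<otimes> y [^] n)"
proof -
  interpret f: group_hom G "tensor QZ G" "frac_tensor G k" for k by (rule frac_tensor_group_hom)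
  show ?thesis
    using assms frac_tensor_expand[of x m n] frac_tensor_expand[of y n m]
    by (simp add: mult.commute[of m] del: f.hom_nat_pow)
qed

text \<open>A pure tensor \<open>p/s \<otimes> a\<close> equals \<open>1/s \<otimes> p a\<close>, and a difference is brought to a common denominator.\<close>

lemma tensor_QZ_fracE:
  assumes "t \<in> carrier (tensor QZ G)"
  obtains n z where "n > 0" "z \<in> carrier G" "t = frac_tensor G n z"
proof -
  interpret f: group_hom G "tensor QZ G" "frac_tensor G k" for k by (rule frac_tensor_group_hom)
  from group_QZ is_group assms have "\<exists>n z. n > 0 \<and> z \<in> carrier G \<and> t = frac_tensor G n z"
  proof (induction t rule: tensor_induct)
    case (pure q a)
    then obtain r where r: "q = QZ_class r" by (auto simp: carrier_QZ)
    obtain p s where ps: "quotient_of r = (p, s)" by force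
    then have s: "s > 0" "r = of_int p / of_int s"
      by (auto intro: quotient_of_denom_pos quotient_of_div)
    then have "pure_tensor QZ G q a = frac_tensor G (nat s) (a [^] p)"
      using pure_tensor_QZ_int_pow[OF pure(2), of "1 / of_int s" p] by (simp add: r frac_tensor_def)
    then show ?case using pure s by (intro exI[of _ "nat s"] exI[of _ "a [^] p"]) auto
  next
    case (diff u v)
    then obtain n x m y where u: "n > 0" "x \<in> carrier G" "u = frac_tensor G n x"
      and v: "m > 0" "y \<in> carrier G" "v = frac_tensor G m y" by blast
    have "u \<otimes>\<^bsub>tensor QZ G\<^esub> inv\<^bsub>tensor QZ G\<^esub> v = frac_tensor G (n * m) (x [^] m \<otimes> (inv y) [^] n)"
      using u v frac_tensor_mult[of x "inv y" n m] by simp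
    moreover have "n * m > 0" "x [^] m \<otimes> (inv y) [^] n \<in> carrier G" using u v by auto
    ultimately show ?case by blast
  qed
  then show ?thesis using that by blast
qed

end

lemma tensor_map_frac:
  assumes "comm_group A" "comm_group B" "f \<in> hom A B" "z \<in> carrier A"
  shows "tensor_map QZ B id f (frac_tensor A n z) = frac_tensor B n (f z)"
  unfolding frac_tensor_def using assms
  by (subst tensor_map_pure) (auto simp: comm_group_is_group comm_group_QZ hom_def)

lemma tensor_map_QZ_hom:
  assumes "comm_group A" "comm_group B" "f \<in> hom A B"
  shows "tensor_map QZ B id f \<in> hom (tensor QZ A) (tensor QZ B)"
  using assms by (intro tensor_map_hom) (auto simp: comm_group_is_group comm_group_QZ hom_def)


section \<open>The exact sequence of a right exact sequence with torsion kernel\<close>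

text \<open>Injectivity: if \<open>1/n \<otimes> z\<close> becomes zero, then the image of \<open>z\<close> is divisible by \<open>n\<close> modulo torsion in the
  torsion-free quotient, that is, divisible by \<open>n\<close> there; so \<open>z \<in> n A + A\<^sub>T\<^sub>o\<^sub>r\<^sub>s\<close>.\<close>

lemma tors_free_tensor_iso:
  assumes A: "comm_group A"
  shows "tensor_map QZ (tors_free A) id (tors_free_proj A) \<in> iso (tensor QZ A) (tensor QZ (tors_free A))"
proof -
  interpret A: comm_group A by fact
  interpret B: comm_group "tors_free A" using A by (rule comm_group_tors_free)
  interpret TA: comm_group "tensor QZ A" by (rule A.comm_group_QZ_tensor)
  interpret TB: comm_group "tensor QZ (tors_free A)" by (rule B.comm_group_QZ_tensor)
  note hom = tors_free_proj_hom[OF A]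
  note frac = tensor_map_frac[OF A B.comm_group_axioms hom]
  interpret p: group_hom A "tors_free A" "tors_free_proj A"
    by (intro group_homI hom A.is_group B.is_group)
  interpret h: group_hom "tensor QZ A" "tensor QZ (tors_free A)" "tensor_map QZ (tors_free A) id (tors_free_proj A)"
    by (intro group_homI tensor_map_QZ_hom hom A B.comm_group_axioms TA.is_group TB.is_group)
  show ?thesis
    unfolding h.iso_iff
  proof (intro conjI subsetI ballI impI)
    fix t assume "t \<in> carrier (tensor QZ (tors_free A))"
    then obtain n z where "n > 0" "z \<in> carrier (tors_free A)" "t = frac_tensor (tors_free A) n z"
      by (rule B.tensor_QZ_fracE)
    then obtain a where "a \<in> carrier A" "t = frac_tensor (tors_free A) n (tors_free_proj A a)"
      by (auto simp: carrier_tors_free)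
    then have "t = tensor_map QZ (tors_free A) id (tors_free_proj A) (frac_tensor A n a)"
      by (simp add: frac)
    then show "t \<in> tensor_map QZ (tors_free A) id (tors_free_proj A) ` carrier (tensor QZ A)"
      using A.frac_tensor_closed[OF \<open>a \<in> carrier A\<close>] by blast
  next
    fix t assume "t \<in> carrier (tensor QZ A)"
      and t: "tensor_map QZ (tors_free A) id (tors_free_proj A) t = \<one>\<^bsub>tensor QZ (tors_free A)\<^esub>"
    then obtain n z where nz: "n > 0" "z \<in> carrier A" "t = frac_tensor A n z"
      by (blast elim: A.tensor_QZ_fracE)
    have "tors_free_proj A z \<in> divisible_mod_torsion (tors_free A) n"
      using t nz B.frac_tensor_eq_one_iff[of "tors_free_proj A z" n] by (simp add: frac)
    then obtain c' u where "tors_free_proj A z = c' [^]\<^bsub>tors_free A\<^esub> n \<otimes>\<^bsub>tors_free A\<^esub> u"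
      "c' \<in> carrier (tors_free A)" "u \<in> torsion (tors_free A)"
      by (rule B.divisible_mod_torsionE)
    then have "tors_free_proj A z = c' [^]\<^bsub>tors_free A\<^esub> n" "c' \<in> tors_free_proj A ` carrier A"
      by (simp_all add: torsion_tors_free[OF A] carrier_tors_free[symmetric])
    then obtain c where c: "c \<in> carrier A"
      "tors_free_proj A z = tors_free_proj A c [^]\<^bsub>tors_free A\<^esub> n"
      by blast
    have "tors_free_proj A (inv\<^bsub>A\<^esub> (c [^]\<^bsub>A\<^esub> n) \<otimes>\<^bsub>A\<^esub> z) = \<one>\<^bsub>tors_free A\<^esub>"
      using c nz by (simp add: p.hom_nat_pow)
    then have "inv\<^bsub>A\<^esub> (c [^]\<^bsub>A\<^esub> n) \<otimes>\<^bsub>A\<^esub> z \<in> torsion A"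
      using c nz by (subst tors_free_proj_eq_one_iff[OF A, symmetric]) auto
    from A.divisible_mod_torsionI[OF c(1) this, of n] have "z \<in> divisible_mod_torsion A n"
      using c nz by (simp add: A.m_assoc[symmetric])
    then show "t = \<one>\<^bsub>tensor QZ A\<^esub>"
      using nz by (simp add: A.frac_tensor_eq_one_iff)
  qed
qed

locale torsion_kernel_sequence =
  A1: comm_group A1 + A2: comm_group A2 + A3: comm_group A3
  for A1 :: "'a monoid" and A2 :: "'b monoid" and A3 :: "'c monoid" +
  fixes i :: "'a \<Rightarrow> 'b" and j :: "'b \<Rightarrow> 'c"
  assumes i_hom: "i \<in> hom A1 A2"
    and j_hom: "j \<in> hom A2 A3"
    and exact: "i ` carrier A1 = kernel A2 A3 j"
    and surj: "j ` carrier A2 = carrier A3"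
    and kernel_torsion: "\<And>x. x \<in> carrier A1 \<Longrightarrow> i x = \<one>\<^bsub>A2\<^esub> \<Longrightarrow> x \<in> torsion A1"
begin

sublocale i: group_hom A1 A2 i
  by (intro group_homI i_hom A1.is_group A2.is_group)

sublocale j: group_hom A2 A3 j
  by (intro group_homI j_hom A2.is_group A3.is_group)

sublocale T1: comm_group "tensor QZ A1" by (rule A1.comm_group_QZ_tensor)
sublocale T2: comm_group "tensor QZ A2" by (rule A2.comm_group_QZ_tensor)
sublocale T3: comm_group "tensor QZ A3" by (rule A3.comm_group_QZ_tensor)

abbreviation "Qi \<equiv> tensor_map QZ A2 id i"
abbreviation "Qj \<equiv> tensor_map QZ A3 id j"

sublocale Qi: group_hom "tensor QZ A1" "tensor QZ A2" Qi
  by (intro group_homI tensor_map_QZ_hom i_hom A1.comm_group_axioms A2.comm_group_axioms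
      T1.is_group T2.is_group)

sublocale Qj: group_hom "tensor QZ A2" "tensor QZ A3" Qj
  by (intro group_homI tensor_map_QZ_hom j_hom A2.comm_group_axioms A3.comm_group_axioms
      T2.is_group T3.is_group)

lemma Qi_frac: "z \<in> carrier A1 \<Longrightarrow> Qi (frac_tensor A1 n z) = frac_tensor A2 n (i z)"
  by (rule tensor_map_frac[OF A1.comm_group_axioms A2.comm_group_axioms i_hom])

lemma Qj_frac: "z \<in> carrier A2 \<Longrightarrow> Qj (frac_tensor A2 n z) = frac_tensor A3 n (j z)"
  by (rule tensor_map_frac[OF A2.comm_group_axioms A3.comm_group_axioms j_hom])

lemma j_i: "x \<in> carrier A1 \<Longrightarrow> j (i x) = \<one>\<^bsub>A3\<^esub>"
  using imageI[of x "carrier A1" i] unfolding exact by (simp add: kernel_def)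

lemma kernel_jE:
  assumes "y \<in> carrier A2" "j y = \<one>\<^bsub>A3\<^esub>"
  obtains x where "x \<in> carrier A1" "y = i x"
proof -
  from assms have "y \<in> i ` carrier A1" unfolding exact by (simp add: kernel_def)
  then show ?thesis by (rule imageE) (rule that)
qed

text \<open>If \<open>n i(x) = 0\<close>, then \<open>n x\<close> lies in the kernel of \<open>i\<close>, which is torsion.\<close>

lemma i_torsion_imp_torsion:
  assumes "x \<in> carrier A1" "i x \<in> torsion A2" shows "x \<in> torsion A1"
proof -
  obtain n :: nat where n: "n > 0" "i x [^]\<^bsub>A2\<^esub> n = \<one>\<^bsub>A2\<^esub>"
    using assms(2) unfolding torsion_def by blast
  have "i (x [^]\<^bsub>A1\<^esub> n) = \<one>\<^bsub>A2\<^esub>"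
    using n(2) i.hom_nat_pow[OF assms(1)] by simp
  then have "x [^]\<^bsub>A1\<^esub> n \<in> torsion A1"
    by (rule kernel_torsion[OF A1.nat_pow_closed[OF assms(1)]])
  then show ?thesis by (rule torsion_if_pow_torsion[OF A1.is_group assms(1) n(1)])
qed

text \<open>The relation that holds between \<open>c\<close> and \<open>(n, z)\<close> if some choice of a lift makes \<open>1/n \<otimes> z\<close> the value
  of the connecting homomorphism at \<open>c\<close>.\<close>

definition connects :: "'c \<Rightarrow> nat \<Rightarrow> 'a \<Rightarrow> bool" where
  "connects c n z \<longleftrightarrow> n > 0 \<and> z \<in> carrier A1 \<and>
     (\<exists>a\<in>carrier A2. j a = c \<and> a [^]\<^bsub>A2\<^esub> n = i z)"

lemma connectsI:
  "n > 0 \<Longrightarrow> z \<in> carrier A1 \<Longrightarrow> a \<in> carrier A2 \<Longrightarrow> a [^]\<^bsub>A2\<^esub> n = i z \<Longrightarrow> connects (j a) n z"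
  by (auto simp: connects_def)

lemma connectsE:
  assumes "connects c n z"
  obtains a where "n > 0" "z \<in> carrier A1" "a \<in> carrier A2" "c = j a" "a [^]\<^bsub>A2\<^esub> n = i z"
  using assms by (auto simp: connects_def)

lemma connects_torsion: "connects c n z \<Longrightarrow> c \<in> torsion A3"
proof (elim connectsE)
  fix a assume a: "n > 0" "z \<in> carrier A1" "a \<in> carrier A2" "c = j a" "a [^]\<^bsub>A2\<^esub> n = i z"
  have "c [^]\<^bsub>A3\<^esub> n = j (i z)" unfolding a(4) a(5)[symmetric] using a(3) by (rule j.hom_nat_pow[symmetric])
  also have "\<dots> = \<one>\<^bsub>A3\<^esub>" using a(2) by (rule j_i)
  finally have "c [^]\<^bsub>A3\<^esub> n = \<one>\<^bsub>A3\<^esub>" .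
  with a show ?thesis by (auto simp: torsion_def)
qed

lemma connects_exists:
  assumes "c \<in> torsion A3" obtains n z where "connects c n z"
proof -
  from assms obtain n :: nat where n: "c \<in> carrier A3" "n > 0" "c [^]\<^bsub>A3\<^esub> n = \<one>\<^bsub>A3\<^esub>"
    by (auto simp: torsion_def)
  from n(1) surj obtain a where a: "a \<in> carrier A2" "c = j a" by blast
  then have "j (a [^]\<^bsub>A2\<^esub> n) = \<one>\<^bsub>A3\<^esub>" using n by (simp add: j.hom_nat_pow)
  with a obtain z where "z \<in> carrier A1" "a [^]\<^bsub>A2\<^esub> n = i z"
    using kernel_jE[of "a [^]\<^bsub>A2\<^esub> n"] by auto
  then show ?thesis using that[of n z] connectsI[of n z a] n a by simp
qed

lemma connects_mult:
  assumes "connects c n z" "connects e m w"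
  shows "connects (c \<otimes>\<^bsub>A3\<^esub> e) (n * m) (z [^]\<^bsub>A1\<^esub> m \<otimes>\<^bsub>A1\<^esub> w [^]\<^bsub>A1\<^esub> n)"
proof -
  from assms(1) obtain a where a: "n > 0" "z \<in> carrier A1" "a \<in> carrier A2" "c = j a" "a [^]\<^bsub>A2\<^esub> n = i z"
    by (rule connectsE)
  from assms(2) obtain b where b: "m > 0" "w \<in> carrier A1" "b \<in> carrier A2" "e = j b" "b [^]\<^bsub>A2\<^esub> m = i w"
    by (rule connectsE)
  have "(a \<otimes>\<^bsub>A2\<^esub> b) [^]\<^bsub>A2\<^esub> (n * m) = a [^]\<^bsub>A2\<^esub> (n * m) \<otimes>\<^bsub>A2\<^esub> b [^]\<^bsub>A2\<^esub> (m * n)"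
    using a b by (simp add: A2.nat_pow_distrib mult.commute[of m])
  also have "\<dots> = (a [^]\<^bsub>A2\<^esub> n) [^]\<^bsub>A2\<^esub> m \<otimes>\<^bsub>A2\<^esub> (b [^]\<^bsub>A2\<^esub> m) [^]\<^bsub>A2\<^esub> n"
    using a(3) b(3) by (simp add: A2.nat_pow_pow)
  also have "\<dots> = i (z [^]\<^bsub>A1\<^esub> m \<otimes>\<^bsub>A1\<^esub> w [^]\<^bsub>A1\<^esub> n)"
    unfolding a(5) b(5) using a b by (simp add: i.hom_nat_pow)
  finally have "connects (j (a \<otimes>\<^bsub>A2\<^esub> b)) (n * m) (z [^]\<^bsub>A1\<^esub> m \<otimes>\<^bsub>A1\<^esub> w [^]\<^bsub>A1\<^esub> n)"
    using a b by (intro connectsI) auto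
  then show ?thesis using a b by simp
qed

text \<open>A lift \<open>a\<close> of zero has the form \<open>i u\<close>, whence \<open>i (z - n u) = 0\<close>. Here it is used that the kernel of \<open>i\<close> is torsion:
  it gives \<open>z \<in> n A\<^sub>1 + A\<^sub>1\<^sub>,\<^sub>T\<^sub>o\<^sub>r\<^sub>s\<close>.\<close>

lemma connects_one:
  assumes "connects \<one>\<^bsub>A3\<^esub> n z" shows "frac_tensor A1 n z = \<one>\<^bsub>tensor QZ A1\<^esub>"
proof -
  from assms obtain a where a: "n > 0" "z \<in> carrier A1" "a \<in> carrier A2" "\<one>\<^bsub>A3\<^esub> = j a" "a [^]\<^bsub>A2\<^esub> n = i z"
    by (rule connectsE)
  from kernel_jE[OF a(3) a(4)[symmetric]] obtain u where u: "u \<in> carrier A1" "a = i u" .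
  have "i (inv\<^bsub>A1\<^esub> (u [^]\<^bsub>A1\<^esub> n) \<otimes>\<^bsub>A1\<^esub> z) = \<one>\<^bsub>A2\<^esub>"
    using a u by (simp add: i.hom_nat_pow)
  then have "inv\<^bsub>A1\<^esub> (u [^]\<^bsub>A1\<^esub> n) \<otimes>\<^bsub>A1\<^esub> z \<in> torsion A1"
    using a u by (intro kernel_torsion) auto
  from A1.divisible_mod_torsionI[OF u(1) this, of n] have "z \<in> divisible_mod_torsion A1 n"
    using a u by (simp add: A1.m_assoc[symmetric])
  then show ?thesis using a by (simp add: A1.frac_tensor_eq_one_iff)
qed

lemma connects_inv:
  assumes "connects c n z" shows "connects (inv\<^bsub>A3\<^esub> c) n (inv\<^bsub>A1\<^esub> z)"
proof -
  from assms obtain a where a: "n > 0" "z \<in> carrier A1" "a \<in> carrier A2" "c = j a" "a [^]\<^bsub>A2\<^esub> n = i z"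
    by (rule connectsE)
  then have "connects (j (inv\<^bsub>A2\<^esub> a)) n (inv\<^bsub>A1\<^esub> z)"
    by (intro connectsI) (auto simp: A2.nat_pow_inv)
  then show ?thesis using a by simp
qed

text \<open>The relation is compatible with the group operations, so the difference of two candidates for the
  value at \<open>c\<close> is a candidate for the value at zero.\<close>

lemma connects_unique:
  assumes "connects c n z" "connects c m w"
  shows "frac_tensor A1 n z = frac_tensor A1 m w"
proof -
  interpret f: group_hom A1 "tensor QZ A1" "frac_tensor A1 k" for k by (rule A1.frac_tensor_group_hom)
  have c: "c \<in> carrier A3" using connects_torsion[OF assms(1)] by (simp add: torsion_def)
  have nz: "n > 0" "z \<in> carrier A1" "m > 0" "w \<in> carrier A1" using assms by (auto simp: connects_def)
  have "connects \<one>\<^bsub>A3\<^esub> (n * m) (z [^]\<^bsub>A1\<^esub> m \<otimes>\<^bsub>A1\<^esub> (inv\<^bsub>A1\<^esub> w) [^]\<^bsub>A1\<^esub> n)"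
    using connects_mult[OF assms(1) connects_inv[OF assms(2)]] c by simp
  from connects_one[OF this]
  have "frac_tensor A1 n z \<otimes>\<^bsub>tensor QZ A1\<^esub> inv\<^bsub>tensor QZ A1\<^esub> frac_tensor A1 m w = \<one>\<^bsub>tensor QZ A1\<^esub>"
    using A1.frac_tensor_mult[of z "inv\<^bsub>A1\<^esub> w" n m] nz by simp
  then show ?thesis
    using nz A1.frac_tensor_closed T1.inv_solve_right'[of "\<one>\<^bsub>tensor QZ A1\<^esub>"] by simp
qed

lemma exact_at_torsion: "exact_at (Tors A1) i (Tors A2) j (Tors A3)"
  unfolding exact_at_def
proof (intro conjI group_homI group_Tors hom_Tors i_hom j_hom A1.is_group A2.is_group A3.is_group
    A1.comm_group_axioms A2.comm_group_axioms A3.comm_group_axioms)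
  show "i ` carrier (Tors A1) = kernel (Tors A2) (Tors A3) j"
    unfolding kernel_Tors
  proof (intro equalityI subsetI)
    fix y assume "y \<in> i ` carrier (Tors A1)"
    then obtain x where x: "x \<in> torsion A1" "y = i x" by (auto simp: Tors_def)
    then have "x \<in> carrier A1" by (simp add: torsion_def)
    then show "y \<in> {y \<in> torsion A2. j y = \<one>\<^bsub>A3\<^esub>}"
      using x hom_torsion[OF A1.is_group A2.is_group i_hom x(1)] by (simp add: j_i)
  next
    fix y assume y: "y \<in> {y \<in> torsion A2. j y = \<one>\<^bsub>A3\<^esub>}"
    then obtain x where x: "x \<in> carrier A1" "y = i x"
      by (auto simp: torsion_def elim: kernel_jE)
    with y have "x \<in> torsion A1" using i_torsion_imp_torsion by simp
    with x show "y \<in> i ` carrier (Tors A1)" by (simp add: Tors_def)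
  qed
qed

text \<open>If \<open>1/n \<otimes> j y = 0\<close>, then \<open>j y = n j(b) + u\<close> with \<open>m u = 0\<close>. Replacing \<open>y\<close> by \<open>y' = y - n b\<close> does not change
  \<open>1/n \<otimes> y\<close>, and \<open>m y'\<close> lies in the kernel of \<open>j\<close>, hence comes from \<open>A\<^sub>1\<close>.\<close>

lemma exact_at_tensor: "exact_at (tensor QZ A1) Qi (tensor QZ A2) Qj (tensor QZ A3)"
  unfolding exact_at_def
proof (intro conjI Qi.group_hom_axioms Qj.group_hom_axioms equalityI subsetI)
  fix t assume "t \<in> Qi ` carrier (tensor QZ A1)"
  then obtain s where s: "s \<in> carrier (tensor QZ A1)" "t = Qi s" by blast
  from s(1) obtain n z where nz: "n > 0" "z \<in> carrier A1" "s = frac_tensor A1 n z"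
    by (rule A1.tensor_QZ_fracE)
  interpret f: group_hom A3 "tensor QZ A3" "frac_tensor A3 n" by (rule A3.frac_tensor_group_hom)
  have "Qj t = \<one>\<^bsub>tensor QZ A3\<^esub>" using nz by (simp add: s Qi_frac Qj_frac j_i)
  then show "t \<in> kernel (tensor QZ A2) (tensor QZ A3) Qj" using s by (simp add: kernel_def)
next
  fix t assume "t \<in> kernel (tensor QZ A2) (tensor QZ A3) Qj"
  then have t: "t \<in> carrier (tensor QZ A2)" "Qj t = \<one>\<^bsub>tensor QZ A3\<^esub>" by (auto simp: kernel_def)
  from t(1) obtain n y where ny: "n > 0" "y \<in> carrier A2" "t = frac_tensor A2 n y"
    by (rule A2.tensor_QZ_fracE)
  interpret f: group_hom A2 "tensor QZ A2" "frac_tensor A2 n" by (rule A2.frac_tensor_group_hom)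
  from t(2) have "j y \<in> divisible_mod_torsion A3 n"
    using ny A3.frac_tensor_eq_one_iff[of "j y" n] by (simp add: Qj_frac)
  then obtain c u where c: "j y = c [^]\<^bsub>A3\<^esub> n \<otimes>\<^bsub>A3\<^esub> u" "c \<in> carrier A3" "u \<in> torsion A3" "u \<in> carrier A3"
    by (rule A3.divisible_mod_torsionE)
  from c(2) surj obtain b where b: "b \<in> carrier A2" "c = j b" by blast
  from c(3) obtain m :: nat where m: "m > 0" "u [^]\<^bsub>A3\<^esub> m = \<one>\<^bsub>A3\<^esub>" by (auto simp: torsion_def)
  define y' where "y' = inv\<^bsub>A2\<^esub> (b [^]\<^bsub>A2\<^esub> n) \<otimes>\<^bsub>A2\<^esub> y"
  have y': "y' \<in> carrier A2" using b ny by (simp add: y'_def)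
  have "j y' = u" unfolding y'_def using b ny c by (simp add: j.hom_nat_pow A3.m_assoc[symmetric])
  then have "j (y' [^]\<^bsub>A2\<^esub> m) = \<one>\<^bsub>A3\<^esub>" using m y' by (simp add: j.hom_nat_pow)
  then obtain z where z: "z \<in> carrier A1" "y' [^]\<^bsub>A2\<^esub> m = i z"
    using y' kernel_jE[of "y' [^]\<^bsub>A2\<^esub> m"] by auto
  have "frac_tensor A2 n y' = t"
    unfolding y'_def using b ny A2.frac_tensor_pow[of b n] by (simp add: A2.frac_tensor_closed)
  then have "t = Qi (frac_tensor A1 (n * m) z)"
    using A2.frac_tensor_expand[OF y' m(1), of n] z by (simp add: Qi_frac)
  then show "t \<in> Qi ` carrier (tensor QZ A1)" using A1.frac_tensor_closed[OF z(1)] by blast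
qed

lemma Qj_surj: "Qj ` carrier (tensor QZ A2) = carrier (tensor QZ A3)"
proof (intro equalityI subsetI)
  fix t assume "t \<in> carrier (tensor QZ A3)"
  then obtain n z where nz: "n > 0" "z \<in> carrier A3" "t = frac_tensor A3 n z"
    by (rule A3.tensor_QZ_fracE)
  from nz(2) surj obtain a where "a \<in> carrier A2" "z = j a" by blast
  then have "t = Qj (frac_tensor A2 n a)" "frac_tensor A2 n a \<in> carrier (tensor QZ A2)"
    using nz by (simp_all add: Qj_frac A2.frac_tensor_closed)
  then show "t \<in> Qj ` carrier (tensor QZ A2)" by blast
qed auto

text \<open>The exactness statements that involve the connecting map are proved for any function \<open>d\<close> with the values
  prescribed by \<open>connects\<close>, so that they apply to a function with an independent definition.\<close>

context
  fixes d
  assumes d: "\<And>c n z. connects c n z \<Longrightarrow> d c = frac_tensor A1 n z"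
begin

lemma connecting_hom: "d \<in> hom (Tors A3) (tensor QZ A1)"
proof (rule homI)
  fix c assume "c \<in> carrier (Tors A3)"
  then have c: "c \<in> torsion A3" by (simp add: Tors_def)
  then obtain n z where nz: "connects c n z" by (rule connects_exists)
  then have z: "n > 0" "z \<in> carrier A1" by (auto simp: connects_def)
  then show "d c \<in> carrier (tensor QZ A1)" by (simp add: d[OF nz] A1.frac_tensor_closed)
  fix e assume "e \<in> carrier (Tors A3)"
  then have "e \<in> torsion A3" by (simp add: Tors_def)
  then obtain m w where mw: "connects e m w" by (rule connects_exists)
  then have w: "m > 0" "w \<in> carrier A1" by (auto simp: connects_def)
  show "d (c \<otimes>\<^bsub>Tors A3\<^esub> e) = d c \<otimes>\<^bsub>tensor QZ A1\<^esub> d e"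
    using d[OF nz] d[OF mw] d[OF connects_mult[OF nz mw]] A1.frac_tensor_mult[OF z(2) w(2) z(1) w(1)]
    by (simp add: Tors_def)
qed

lemma connecting_group_hom: "group_hom (Tors A3) (tensor QZ A1) d"
  by (intro group_homI group_Tors connecting_hom T1.is_group A3.comm_group_axioms)

text \<open>If \<open>1/n \<otimes> z = 0\<close>, where \<open>n a = i z\<close>, then \<open>z = n b + t\<close> with \<open>t\<close> torsion, and \<open>a - i b\<close> is another lift of
  the same element, torsion because \<open>n (a - i b) = i t\<close>.\<close>

lemma exact_at_connecting_source: "exact_at (Tors A2) j (Tors A3) d (tensor QZ A1)"
  unfolding exact_at_def
proof (intro conjI group_homI group_Tors hom_Tors j_hom A2.is_group A3.is_group T1.is_group
    A2.comm_group_axioms A3.comm_group_axioms connecting_hom equalityI subsetI)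
  fix c assume "c \<in> j ` carrier (Tors A2)"
  then obtain a n where a: "a \<in> carrier A2" "(n::nat) > 0" "a [^]\<^bsub>A2\<^esub> n = \<one>\<^bsub>A2\<^esub>" "c = j a"
    by (auto simp: Tors_def torsion_def)
  interpret f: group_hom A1 "tensor QZ A1" "frac_tensor A1 n" by (rule A1.frac_tensor_group_hom)
  have con: "connects c n \<one>\<^bsub>A1\<^esub>" using a by (auto intro!: connectsI)
  then have "d c = \<one>\<^bsub>tensor QZ A1\<^esub>" using d[OF con] by simp
  with connects_torsion[OF con] show "c \<in> kernel (Tors A3) (tensor QZ A1) d"
    by (simp add: kernel_def Tors_def)
next
  fix c assume "c \<in> kernel (Tors A3) (tensor QZ A1) d"
  then have c: "c \<in> torsion A3" "d c = \<one>\<^bsub>tensor QZ A1\<^esub>" by (auto simp: kernel_def Tors_def)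
  from c(1) obtain n z where nz: "connects c n z" by (rule connects_exists)
  then obtain a where a: "n > 0" "z \<in> carrier A1" "a \<in> carrier A2" "c = j a" "a [^]\<^bsub>A2\<^esub> n = i z"
    by (rule connectsE)
  have "z \<in> divisible_mod_torsion A1 n"
    using c d[OF nz] A1.frac_tensor_eq_one_iff[of z n] a by simp
  then obtain b t where b: "z = b [^]\<^bsub>A1\<^esub> n \<otimes>\<^bsub>A1\<^esub> t" "b \<in> carrier A1" "t \<in> torsion A1" "t \<in> carrier A1"
    by (rule A1.divisible_mod_torsionE)
  define a' where "a' = inv\<^bsub>A2\<^esub> (i b) \<otimes>\<^bsub>A2\<^esub> a"
  have a': "a' \<in> carrier A2" using a b by (simp add: a'_def)
  have "a' [^]\<^bsub>A2\<^esub> n = inv\<^bsub>A2\<^esub> (i b [^]\<^bsub>A2\<^esub> n) \<otimes>\<^bsub>A2\<^esub> i z"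
    unfolding a'_def a(5)[symmetric] using a(3) b(2) by (simp add: A2.nat_pow_distrib A2.nat_pow_inv)
  also have "\<dots> = i t" unfolding b(1) 
    using b(2,4) A2.m_assoc[of "inv\<^bsub>A2\<^esub> (i b [^]\<^bsub>A2\<^esub> n)" "i b [^]\<^bsub>A2\<^esub> n" "i t"]
    by (simp add: i.hom_nat_pow)
  finally have "a' [^]\<^bsub>A2\<^esub> n \<in> torsion A2"
    using hom_torsion[OF A1.is_group A2.is_group i_hom b(3)] by simp
  then have "a' \<in> torsion A2" by (rule torsion_if_pow_torsion[OF A2.is_group a' a(1)])
  moreover have "c = j a'" unfolding a(4) a'_def using a(3) b(2) by (simp add: j_i)
  ultimately show "c \<in> j ` carrier (Tors A2)" by (simp add: Tors_def)
qed

text \<open>If \<open>1/n \<otimes> i z = 0\<close>, then \<open>i z = n a + u\<close> with \<open>m u = 0\<close>. So \<open>i (m z) = n m a\<close>, and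
  \<open>1/n \<otimes> z = 1/(n m) \<otimes> m z\<close> is the value at \<open>j a\<close>.\<close>

lemma exact_at_connecting_target: "exact_at (Tors A3) d (tensor QZ A1) Qi (tensor QZ A2)"
  unfolding exact_at_def
proof (intro conjI connecting_group_hom Qi.group_hom_axioms equalityI subsetI)
  fix t assume "t \<in> d ` carrier (Tors A3)"
  then obtain c where c: "c \<in> torsion A3" "t = d c" by (auto simp: Tors_def)
  from c(1) obtain n z where nz: "connects c n z" by (rule connects_exists)
  then obtain a where a: "n > 0" "z \<in> carrier A1" "a \<in> carrier A2" "c = j a" "a [^]\<^bsub>A2\<^esub> n = i z"
    by (rule connectsE)
  have "Qi t = \<one>\<^bsub>tensor QZ A2\<^esub>"
    unfolding c(2) d[OF nz] Qi_frac[OF a(2)] a(5)[symmetric] using a(3,1) by (rule A2.frac_tensor_pow)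
  moreover have "t \<in> carrier (tensor QZ A1)"
    unfolding c(2) d[OF nz] using a(2) by (rule A1.frac_tensor_closed)
  ultimately show "t \<in> kernel (tensor QZ A1) (tensor QZ A2) Qi" by (simp add: kernel_def)
next
  fix t assume "t \<in> kernel (tensor QZ A1) (tensor QZ A2) Qi"
  then have t: "t \<in> carrier (tensor QZ A1)" "Qi t = \<one>\<^bsub>tensor QZ A2\<^esub>" by (auto simp: kernel_def)
  from t(1) obtain n z where nz: "n > 0" "z \<in> carrier A1" "t = frac_tensor A1 n z"
    by (rule A1.tensor_QZ_fracE)
  from t(2) have "i z \<in> divisible_mod_torsion A2 n"
    using nz A2.frac_tensor_eq_one_iff[of "i z" n] by (simp add: Qi_frac)
  then obtain a u where a: "i z = a [^]\<^bsub>A2\<^esub> n \<otimes>\<^bsub>A2\<^esub> u" "a \<in> carrier A2" "u \<in> torsion A2" "u \<in> carrier A2"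
    by (rule A2.divisible_mod_torsionE)
  from a(3) obtain m :: nat where m: "m > 0" "u [^]\<^bsub>A2\<^esub> m = \<one>\<^bsub>A2\<^esub>" by (auto simp: torsion_def)
  have "a [^]\<^bsub>A2\<^esub> (n * m) = i (z [^]\<^bsub>A1\<^esub> m)"
    using nz a m by (simp add: i.hom_nat_pow A2.nat_pow_distrib A2.nat_pow_pow)
  then have con: "connects (j a) (n * m) (z [^]\<^bsub>A1\<^esub> m)"
    using nz m a by (intro connectsI) auto
  have "d (j a) = t" unfolding d[OF con] nz(3) using nz(2) m(1) by (rule A1.frac_tensor_expand)
  with connects_torsion[OF con] show "t \<in> d ` carrier (Tors A3)" by (auto simp: Tors_def)
qed

end

end


section \<open>Coinvariants\<close>

lemma hom_finprod:
  assumes "comm_group G" "comm_group H" "h \<in> hom G H" "f \<in> A \<rightarrow> carrier G"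
  shows "h (finprod G f A) = finprod H (\<lambda>x. h (f x)) A"
proof -
  interpret G: comm_group G by fact
  interpret H: comm_group H by fact
  interpret group_hom G H h using assms by (intro group_homI G.is_group H.is_group)
  show ?thesis
    using assms(4)
  proof (induction A rule: infinite_finite_induct)
    case (insert x F)
    have f: "f \<in> F \<rightarrow> carrier G" "f x \<in> carrier G" using insert.prems by auto
    have "(\<lambda>x. h (f x)) \<in> F \<rightarrow> carrier H" using f by (auto intro!: hom_closed)
    then show ?case using insert f by (simp add: G.finprod_insert H.finprod_insert)
  qed auto
qed

lemma finprod_in_subgroup:
  assumes "comm_group G" "subgroup K G" "f \<in> A \<rightarrow> K"
  shows "finprod G f A \<in> K"
proof -
  interpret G: comm_group G by fact
  interpret K: subgroup K G by fact
  show ?thesis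
    using assms(3)
  proof (induction A rule: infinite_finite_induct)
    case (insert x F)
    then have "f \<in> F \<rightarrow> K" "f x \<in> K" by auto
    moreover have "f \<in> F \<rightarrow> carrier G" using calculation(1) K.mem_carrier by blast
    ultimately show ?case using insert by (simp add: G.finprod_insert)
  qed auto
qed

lemma is_gmodule_act:
  assumes "is_gmodule \<Gamma> B"
  shows act_hom: "\<gamma> \<in> carrier \<Gamma> \<Longrightarrow> act B \<gamma> \<in> hom B B"
    and act_mult: "\<gamma> \<in> carrier \<Gamma> \<Longrightarrow> \<delta> \<in> carrier \<Gamma> \<Longrightarrow> b \<in> carrier B \<Longrightarrow>
          act B (\<gamma> \<otimes>\<^bsub>\<Gamma>\<^esub> \<delta>) b = act B \<gamma> (act B \<delta> b)"
proof -
  have h: "act B \<in> hom \<Gamma> (AutoGroup B)" using assms by (simp add: is_gmodule_def)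
  have auto: "act B \<gamma> \<in> auto B" if "\<gamma> \<in> carrier \<Gamma>" for \<gamma>
    using hom_in_carrier[OF h that] by (simp add: AutoGroup_def)
  then show "act B \<gamma> \<in> hom B B" if "\<gamma> \<in> carrier \<Gamma>" using that by (simp add: auto_def)
  show "act B (\<gamma> \<otimes>\<^bsub>\<Gamma>\<^esub> \<delta>) b = act B \<gamma> (act B \<delta> b)"
    if "\<gamma> \<in> carrier \<Gamma>" "\<delta> \<in> carrier \<Gamma>" "b \<in> carrier B"
    using hom_mult[OF h that(1,2)] that auto[OF that(1)] auto[OF that(2)]
    by (simp add: AutoGroup_def BijGroup_def auto_def compose_def)
qed

locale gmodule =
  fixes \<Gamma> :: "'g monoid" and B :: "('g, 'a) gmodule"
  assumes is_gmodule: "is_gmodule \<Gamma> B"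
begin

sublocale \<Gamma>: group \<Gamma>
  using is_gmodule by (simp add: is_gmodule_def)

sublocale B: comm_group B
  using is_gmodule by (simp add: is_gmodule_def)

lemma act_group_hom: "\<gamma> \<in> carrier \<Gamma> \<Longrightarrow> group_hom B B (act B \<gamma>)"
  by (intro group_homI act_hom[OF is_gmodule] B.is_group)

lemma act_closed: "\<gamma> \<in> carrier \<Gamma> \<Longrightarrow> b \<in> carrier B \<Longrightarrow> act B \<gamma> b \<in> carrier B"
  by (rule group_hom.hom_closed[OF act_group_hom])

abbreviation generators :: "'a set" where
  "generators \<equiv> {act B \<gamma> b \<otimes>\<^bsub>B\<^esub> inv\<^bsub>B\<^esub> b | \<gamma> b. \<gamma> \<in> carrier \<Gamma> \<and> b \<in> carrier B}"

lemma generators_subset: "generators \<subseteq> carrier B"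
  using act_closed by auto

lemma coinv_rel_subgroup: "subgroup (coinv_rel \<Gamma> B) B"
  unfolding coinv_rel_def by (rule B.generate_is_subgroup[OF generators_subset])

lemma generator_in_coinv_rel:
  "\<gamma> \<in> carrier \<Gamma> \<Longrightarrow> b \<in> carrier B \<Longrightarrow> act B \<gamma> b \<otimes>\<^bsub>B\<^esub> inv\<^bsub>B\<^esub> b \<in> coinv_rel \<Gamma> B"
  unfolding coinv_rel_def by (rule generate.incl) blast

lemma comm_group_coinv: "comm_group (coinv \<Gamma> B)"
  unfolding coinv_def by (intro B.abelian_FactGroup coinv_rel_subgroup)

lemma coinv_class_hom: "coinv_class \<Gamma> B \<in> hom B (coinv \<Gamma> B)"
  unfolding coinv_def coinv_class_def [abs_def]
  by (intro r_coset_hom coinv_rel_subgroup B.comm_group_axioms)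

lemma carrier_coinv: "carrier (coinv \<Gamma> B) = coinv_class \<Gamma> B ` carrier B"
  by (simp add: coinv_def coinv_class_def [abs_def] carrier_FactGroup)

sublocale C: comm_group "coinv \<Gamma> B" by (rule comm_group_coinv)

sublocale cl: group_hom B "coinv \<Gamma> B" "coinv_class \<Gamma> B"
  by (intro group_homI coinv_class_hom B.is_group C.is_group)

lemma coinv_class_eq_one_iff:
  "b \<in> carrier B \<Longrightarrow> coinv_class \<Gamma> B b = \<one>\<^bsub>coinv \<Gamma> B\<^esub> \<longleftrightarrow> b \<in> coinv_rel \<Gamma> B"
  unfolding coinv_def coinv_class_def one_FactGroup
  by (intro r_coset_eq_subgroup_iff coinv_rel_subgroup B.is_group)

lemma act_sum_terms:
  "y \<in> carrier \<Gamma> \<rightarrow> carrier B \<Longrightarrow>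
     (\<lambda>\<gamma>. act B \<gamma> (y \<gamma>) \<otimes>\<^bsub>B\<^esub> inv\<^bsub>B\<^esub> (y \<gamma>)) \<in> carrier \<Gamma> \<rightarrow> carrier B"
  by (auto intro!: act_closed simp: Pi_iff)

lemma act_sum_in_coinv_rel:
  "y \<in> carrier \<Gamma> \<rightarrow> carrier B \<Longrightarrow> act_sum \<Gamma> B y \<in> coinv_rel \<Gamma> B"
  unfolding act_sum_def
  by (rule finprod_in_subgroup[OF B.comm_group_axioms coinv_rel_subgroup])
     (auto intro!: generator_in_coinv_rel simp: Pi_iff)

lemma act_sum_closed: "y \<in> carrier \<Gamma> \<rightarrow> carrier B \<Longrightarrow> act_sum \<Gamma> B y \<in> carrier B"
  unfolding act_sum_def by (intro B.finprod_closed act_sum_terms)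

lemma act_sum_mult:
  assumes "y \<in> carrier \<Gamma> \<rightarrow> carrier B" "y' \<in> carrier \<Gamma> \<rightarrow> carrier B"
  shows "act_sum \<Gamma> B (\<lambda>\<gamma>. y \<gamma> \<otimes>\<^bsub>B\<^esub> y' \<gamma>) = act_sum \<Gamma> B y \<otimes>\<^bsub>B\<^esub> act_sum \<Gamma> B y'"
proof -
  have "act_sum \<Gamma> B (\<lambda>\<gamma>. y \<gamma> \<otimes>\<^bsub>B\<^esub> y' \<gamma>) =
     finprod B (\<lambda>\<gamma>. (act B \<gamma> (y \<gamma>) \<otimes>\<^bsub>B\<^esub> inv\<^bsub>B\<^esub> (y \<gamma>)) \<otimes>\<^bsub>B\<^esub> (act B \<gamma> (y' \<gamma>) \<otimes>\<^bsub>B\<^esub> inv\<^bsub>B\<^esub> (y' \<gamma>))) (carrier \<Gamma>)"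
    unfolding act_sum_def
  proof (rule B.finprod_cong')
    fix \<gamma> assume g: "\<gamma> \<in> carrier \<Gamma>"
    interpret a: group_hom B B "act B \<gamma>" using g by (rule act_group_hom)
    have "y \<gamma> \<in> carrier B" "y' \<gamma> \<in> carrier B" using assms g by auto
    then show "act B \<gamma> (y \<gamma> \<otimes>\<^bsub>B\<^esub> y' \<gamma>) \<otimes>\<^bsub>B\<^esub> inv\<^bsub>B\<^esub> (y \<gamma> \<otimes>\<^bsub>B\<^esub> y' \<gamma>) =
       (act B \<gamma> (y \<gamma>) \<otimes>\<^bsub>B\<^esub> inv\<^bsub>B\<^esub> (y \<gamma>)) \<otimes>\<^bsub>B\<^esub> (act B \<gamma> (y' \<gamma>) \<otimes>\<^bsub>B\<^esub> inv\<^bsub>B\<^esub> (y' \<gamma>))"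
      by (simp add: B.inv_mult B.m_ac)
  qed (use act_sum_terms[OF assms(1)] act_sum_terms[OF assms(2)] in auto)
  also have "\<dots> = act_sum \<Gamma> B y \<otimes>\<^bsub>B\<^esub> act_sum \<Gamma> B y'"
    unfolding act_sum_def using act_sum_terms[OF assms(1)] act_sum_terms[OF assms(2)]
    by (rule B.finprod_multf)
  finally show ?thesis .
qed

text \<open>The subgroup defining the coinvariants is the set of values of \<^const>\<open>act_sum\<close>. Terms
  belonging to the same \<open>\<gamma>\<close> can be collected because \<open>b \<mapsto> \<^sup>\<gamma>b - b\<close> is additive. On an
  infinite index set \<^const>\<open>finprod\<close> would take its default value.\<close>

lemma coinv_rel_act_sumE:
  assumes fin: "finite (carrier \<Gamma>)" and x: "x \<in> coinv_rel \<Gamma> B"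
  obtains y where "y \<in> carrier \<Gamma> \<rightarrow> carrier B" "x = act_sum \<Gamma> B y"
proof -
  have gen: "\<exists>y\<in>carrier \<Gamma> \<rightarrow> carrier B. act B \<gamma> b \<otimes>\<^bsub>B\<^esub> inv\<^bsub>B\<^esub> b = act_sum \<Gamma> B y"
    if g: "\<gamma> \<in> carrier \<Gamma>" "b \<in> carrier B" for \<gamma> b
  proof
    \<comment> \<open>The family concentrated at \<open>\<gamma>\<close>; all other terms of the sum vanish.\<close>
    let ?y = "\<lambda>\<delta>. if \<gamma> = \<delta> then b else \<one>\<^bsub>B\<^esub>"
    show "?y \<in> carrier \<Gamma> \<rightarrow> carrier B" using g by auto
    have "act_sum \<Gamma> B ?y = finprod B (\<lambda>\<delta>. if \<gamma> = \<delta> then act B \<delta> b \<otimes>\<^bsub>B\<^esub> inv\<^bsub>B\<^esub> b else \<one>\<^bsub>B\<^esub>) (carrier \<Gamma>)"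
      unfolding act_sum_def
    proof (rule B.finprod_cong')
      fix \<delta> assume "\<delta> \<in> carrier \<Gamma>"
      then interpret a: group_hom B B "act B \<delta>" by (rule act_group_hom)
      show "act B \<delta> (?y \<delta>) \<otimes>\<^bsub>B\<^esub> inv\<^bsub>B\<^esub> (?y \<delta>) =
        (if \<gamma> = \<delta> then act B \<delta> b \<otimes>\<^bsub>B\<^esub> inv\<^bsub>B\<^esub> b else \<one>\<^bsub>B\<^esub>)" by simp
    qed (use g act_closed in auto)
    also have "\<dots> = act B \<gamma> b \<otimes>\<^bsub>B\<^esub> inv\<^bsub>B\<^esub> b"
      using g fin act_closed by (intro B.finprod_singleton) auto
    finally show "act B \<gamma> b \<otimes>\<^bsub>B\<^esub> inv\<^bsub>B\<^esub> b = act_sum \<Gamma> B ?y" ..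
  qed
  have "\<exists>y\<in>carrier \<Gamma> \<rightarrow> carrier B. x = act_sum \<Gamma> B y"
    using x unfolding coinv_rel_def
  proof (induction rule: generate.induct)
    case one
    interpret a: group_hom B B "act B \<one>\<^bsub>\<Gamma>\<^esub>" by (rule act_group_hom[OF \<Gamma>.one_closed])
    show ?case using gen[OF \<Gamma>.one_closed B.one_closed] by simp
  next
    case (incl h)
    then show ?case using gen by blast
  next
    case (inv h)
    then obtain \<gamma> b where g: "\<gamma> \<in> carrier \<Gamma>" "b \<in> carrier B" "h = act B \<gamma> b \<otimes>\<^bsub>B\<^esub> inv\<^bsub>B\<^esub> b" by blast
    interpret a: group_hom B B "act B \<gamma>" using g by (intro act_group_hom)
    have "inv\<^bsub>B\<^esub> h = act B \<gamma> (inv\<^bsub>B\<^esub> b) \<otimes>\<^bsub>B\<^esub> inv\<^bsub>B\<^esub> (inv\<^bsub>B\<^esub> b)"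
      using g by (simp add: B.inv_mult)
    then show ?case using gen[OF g(1) B.inv_closed[OF g(2)]] by simp
  next
    case (eng h1 h2)
    then obtain y y' where y: "y \<in> carrier \<Gamma> \<rightarrow> carrier B" "h1 = act_sum \<Gamma> B y"
      "y' \<in> carrier \<Gamma> \<rightarrow> carrier B" "h2 = act_sum \<Gamma> B y'" by blast
    then have "h1 \<otimes>\<^bsub>B\<^esub> h2 = act_sum \<Gamma> B (\<lambda>\<gamma>. y \<gamma> \<otimes>\<^bsub>B\<^esub> y' \<gamma>)" by (simp add: act_sum_mult)
    moreover have "(\<lambda>\<gamma>. y \<gamma> \<otimes>\<^bsub>B\<^esub> y' \<gamma>) \<in> carrier \<Gamma> \<rightarrow> carrier B" using y by auto
    ultimately show ?case by blast
  qed
  then show ?thesis using that by blast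
qed

definition norm_map :: "'a \<Rightarrow> 'a" where
  "norm_map b = finprod B (\<lambda>\<gamma>. act B \<gamma> b) (carrier \<Gamma>)"

lemma norm_map_hom: "norm_map \<in> hom B B"
proof (rule homI)
  fix b c assume bc: "b \<in> carrier B" "c \<in> carrier B"
  then have f: "(\<lambda>\<gamma>. act B \<gamma> b) \<in> carrier \<Gamma> \<rightarrow> carrier B" "(\<lambda>\<gamma>. act B \<gamma> c) \<in> carrier \<Gamma> \<rightarrow> carrier B"
    by (auto intro: act_closed)
  then show "norm_map b \<in> carrier B" unfolding norm_map_def by (intro B.finprod_closed)
  have "norm_map (b \<otimes>\<^bsub>B\<^esub> c) = finprod B (\<lambda>\<gamma>. act B \<gamma> b \<otimes>\<^bsub>B\<^esub> act B \<gamma> c) (carrier \<Gamma>)"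
    unfolding norm_map_def
  proof (rule B.finprod_cong')
    fix \<gamma> assume "\<gamma> \<in> carrier \<Gamma>"
    then show "act B \<gamma> (b \<otimes>\<^bsub>B\<^esub> c) = act B \<gamma> b \<otimes>\<^bsub>B\<^esub> act B \<gamma> c"
      using bc by (intro hom_mult act_hom[OF is_gmodule])
  qed (use f in auto)
  also have "\<dots> = norm_map b \<otimes>\<^bsub>B\<^esub> norm_map c"
    unfolding norm_map_def using f by (rule B.finprod_multf)
  finally show "norm_map (b \<otimes>\<^bsub>B\<^esub> c) = norm_map b \<otimes>\<^bsub>B\<^esub> norm_map c" .
qed

sublocale N: group_hom B B norm_map
  by (intro group_homI norm_map_hom B.is_group)

text \<open>Right translation by \<open>\<delta>\<close> permutes \<open>\<Gamma>\<close>.\<close>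

lemma norm_map_act:
  assumes g: "\<delta> \<in> carrier \<Gamma>" and b: "b \<in> carrier B"
  shows "norm_map (act B \<delta> b) = norm_map b"
proof -
  have inj: "inj_on (\<lambda>\<gamma>. \<gamma> \<otimes>\<^bsub>\<Gamma>\<^esub> \<delta>) (carrier \<Gamma>)"
    using g by (auto simp: inj_on_def)
  have "\<gamma> \<in> (\<lambda>\<gamma>. \<gamma> \<otimes>\<^bsub>\<Gamma>\<^esub> \<delta>) ` carrier \<Gamma>" if "\<gamma> \<in> carrier \<Gamma>" for \<gamma>
    using that g by (intro image_eqI[of _ _ "\<gamma> \<otimes>\<^bsub>\<Gamma>\<^esub> inv\<^bsub>\<Gamma>\<^esub> \<delta>"]) (auto simp: \<Gamma>.m_assoc)
  then have im: "(\<lambda>\<gamma>. \<gamma> \<otimes>\<^bsub>\<Gamma>\<^esub> \<delta>) ` carrier \<Gamma> = carrier \<Gamma>" using g by auto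
  have "norm_map b = finprod B (\<lambda>\<gamma>. act B \<gamma> b) ((\<lambda>\<gamma>. \<gamma> \<otimes>\<^bsub>\<Gamma>\<^esub> \<delta>) ` carrier \<Gamma>)"
    unfolding im norm_map_def ..
  also have "\<dots> = finprod B (\<lambda>\<gamma>. act B (\<gamma> \<otimes>\<^bsub>\<Gamma>\<^esub> \<delta>) b) (carrier \<Gamma>)"
    by (rule B.finprod_reindex[OF _ inj]) (use b g in \<open>auto intro: act_closed\<close>)
  also have "\<dots> = norm_map (act B \<delta> b)"
    unfolding norm_map_def
    by (rule B.finprod_cong') (use b g in \<open>auto intro: act_closed simp: act_mult[OF is_gmodule]\<close>)
  finally show ?thesis ..
qed

lemma norm_map_coinv_rel:
  assumes "x \<in> coinv_rel \<Gamma> B" shows "norm_map x = \<one>\<^bsub>B\<^esub>"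
proof -
  have "norm_map ` coinv_rel \<Gamma> B \<subseteq> {\<one>\<^bsub>B\<^esub>}"
    unfolding coinv_rel_def
    by (rule hom_generate_subset[OF B.is_group B.is_group norm_map_hom generators_subset B.triv_subgroup])
       (auto simp: norm_map_act act_closed)
  then show ?thesis using assms by blast
qed

text \<open>Summing \<open>\<^sup>\<gamma>b = (\<^sup>\<gamma>b - b) + b\<close> over \<open>\<gamma>\<close> gives \<open>N b \<equiv> |\<Gamma>| b\<close> in the coinvariants.\<close>

lemma norm_map_one_imp_torsion:
  assumes fin: "finite (carrier \<Gamma>)" and b: "b \<in> carrier B" and N: "norm_map b = \<one>\<^bsub>B\<^esub>"
  shows "coinv_class \<Gamma> B b \<in> torsion (coinv \<Gamma> B)"
proof -
  let ?n = "card (carrier \<Gamma>)"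
  have n: "?n > 0" using fin \<Gamma>.one_closed by (auto simp: card_gt_0_iff)
  have y: "(\<lambda>_. b) \<in> carrier \<Gamma> \<rightarrow> carrier B" using b by auto
  have "norm_map b = finprod B (\<lambda>\<gamma>. (act B \<gamma> b \<otimes>\<^bsub>B\<^esub> inv\<^bsub>B\<^esub> b) \<otimes>\<^bsub>B\<^esub> b) (carrier \<Gamma>)"
    unfolding norm_map_def
    by (rule B.finprod_cong') (use b in \<open>auto intro: act_closed simp: B.m_assoc act_closed\<close>)
  also have "\<dots> = act_sum \<Gamma> B (\<lambda>_. b) \<otimes>\<^bsub>B\<^esub> finprod B (\<lambda>_. b) (carrier \<Gamma>)"
    unfolding act_sum_def using act_sum_terms[OF y] y by (rule B.finprod_multf)
  also have "finprod B (\<lambda>_. b) (carrier \<Gamma>) = b [^]\<^bsub>B\<^esub> ?n"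
    using b by (rule B.finprod_const)
  finally have "coinv_class \<Gamma> B (act_sum \<Gamma> B (\<lambda>_. b) \<otimes>\<^bsub>B\<^esub> b [^]\<^bsub>B\<^esub> ?n) = \<one>\<^bsub>coinv \<Gamma> B\<^esub>"
    using cl.hom_one unfolding N by (simp only:)
  moreover have "coinv_class \<Gamma> B (act_sum \<Gamma> B (\<lambda>_. b)) = \<one>\<^bsub>coinv \<Gamma> B\<^esub>"
    using coinv_class_eq_one_iff act_sum_closed[OF y] act_sum_in_coinv_rel[OF y] by blast
  ultimately have "coinv_class \<Gamma> B b [^]\<^bsub>coinv \<Gamma> B\<^esub> ?n = \<one>\<^bsub>coinv \<Gamma> B\<^esub>"
    using b act_sum_closed[OF y] by (simp add: cl.hom_nat_pow)
  then show ?thesis using n b by (auto simp: torsion_def)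
qed

end

locale gmodule_morphism =
  M: gmodule \<Gamma> B + M': gmodule \<Gamma>' B'
  for \<Gamma> :: "'g monoid" and B :: "('g, 'a) gmodule" and \<Gamma>' :: "'h monoid" and B' :: "('h, 'b) gmodule" +
  fixes \<phi> f
  assumes phi: "\<phi> \<in> hom \<Gamma> \<Gamma>'" and f_gmodule_hom: "f \<in> gmodule_hom \<Gamma> \<phi> B B'"
begin

lemma f_hom: "f \<in> hom B B'"
  using f_gmodule_hom by (simp add: gmodule_hom_def)

sublocale f: group_hom B B' f
  by (intro group_homI f_hom M.B.is_group M'.B.is_group)

lemma f_act: "\<gamma> \<in> carrier \<Gamma> \<Longrightarrow> b \<in> carrier B \<Longrightarrow> f (act B \<gamma> b) = act B' (\<phi> \<gamma>) (f b)"
  using f_gmodule_hom by (simp add: gmodule_hom_def)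

lemma f_coinv_rel: "f ` coinv_rel \<Gamma> B \<subseteq> coinv_rel \<Gamma>' B'"
  unfolding coinv_rel_def[of \<Gamma> B]
proof (rule hom_generate_subset[OF M.B.is_group M'.B.is_group f_hom M.generators_subset M'.coinv_rel_subgroup])
  show "f ` M.generators \<subseteq> coinv_rel \<Gamma>' B'"
    using hom_in_carrier[OF phi]
    by (auto simp: f_act M.act_closed intro!: M'.generator_in_coinv_rel)
qed

lemma coinv_map_class: "b \<in> carrier B \<Longrightarrow> coinv_map \<Gamma>' B' f (coinv_class \<Gamma> B b) = coinv_class \<Gamma>' B' (f b)"
  unfolding coinv_map_def coinv_class_def
  by (rule quot_map_r_coset[OF M.B.is_group M'.B.is_group M.coinv_rel_subgroup M'.coinv_rel_subgroup
        f_hom f_coinv_rel])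

lemma coinv_map_hom: "coinv_map \<Gamma>' B' f \<in> hom (coinv \<Gamma> B) (coinv \<Gamma>' B')"
  unfolding coinv_map_def coinv_def
  by (rule quot_map_hom[OF M.B.comm_group_axioms M'.B.comm_group_axioms
        M.coinv_rel_subgroup M'.coinv_rel_subgroup f_hom f_coinv_rel])

lemma QZ_coinv_map_frac:
  "z \<in> carrier (coinv \<Gamma> B) \<Longrightarrow>
     QZ_coinv_map \<Gamma>' B' f (frac_tensor (coinv \<Gamma> B) n z) = frac_tensor (coinv \<Gamma>' B') n (coinv_map \<Gamma>' B' f z)"
  unfolding QZ_coinv_map_def
  by (rule tensor_map_frac[OF M.comm_group_coinv M'.comm_group_coinv coinv_map_hom])

lemma QZ_coinv_map_hom: "QZ_coinv_map \<Gamma>' B' f \<in> hom (QZ_coinv \<Gamma> B) (QZ_coinv \<Gamma>' B')"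
  unfolding QZ_coinv_map_def QZ_coinv_def
  by (rule tensor_map_QZ_hom[OF M.comm_group_coinv M'.comm_group_coinv coinv_map_hom])

end

lemma (in gmodule) identity_morphism: "gmodule_morphism \<Gamma> B \<Gamma> B id id"
  by unfold_locales (auto simp: hom_def gmodule_hom_def)

lemma hom_act_sum:
  assumes "gmodule_morphism \<Gamma> B \<Gamma> B' id f" "y \<in> carrier \<Gamma> \<rightarrow> carrier B"
    "\<And>\<gamma>. \<gamma> \<in> carrier \<Gamma> \<Longrightarrow> y' \<gamma> = f (y \<gamma>)"
  shows "f (act_sum \<Gamma> B y) = act_sum \<Gamma> B' y'"
proof -
  interpret gmodule_morphism \<Gamma> B \<Gamma> B' id f by fact
  have "f (act_sum \<Gamma> B y) = finprod B' (\<lambda>\<gamma>. f (act B \<gamma> (y \<gamma>) \<otimes>\<^bsub>B\<^esub> inv\<^bsub>B\<^esub> (y \<gamma>))) (carrier \<Gamma>)"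
    unfolding act_sum_def
    by (rule hom_finprod[OF M.B.comm_group_axioms M'.B.comm_group_axioms f_hom M.act_sum_terms[OF assms(2)]])
  also have "\<dots> = act_sum \<Gamma> B' y'"
    unfolding act_sum_def
  proof (rule M'.B.finprod_cong')
    fix \<gamma> assume g: "\<gamma> \<in> carrier \<Gamma>"
    then have y: "y \<gamma> \<in> carrier B" using assms(2) by auto
    then show "f (act B \<gamma> (y \<gamma>) \<otimes>\<^bsub>B\<^esub> inv\<^bsub>B\<^esub> (y \<gamma>)) = act B' \<gamma> (y' \<gamma>) \<otimes>\<^bsub>B'\<^esub> inv\<^bsub>B'\<^esub> (y' \<gamma>)"
      using g by (simp add: assms(3) M.act_closed f_act)
  next
    show "(\<lambda>\<gamma>. act B' \<gamma> (y' \<gamma>) \<otimes>\<^bsub>B'\<^esub> inv\<^bsub>B'\<^esub> (y' \<gamma>)) \<in> carrier \<Gamma> \<rightarrow> carrier B'"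
      using assms(2) by (intro M'.act_sum_terms) (auto simp: assms(3) Pi_iff)
  qed simp
  finally show ?thesis .
qed

lemma norm_map_natural:
  assumes "gmodule_morphism \<Gamma> B \<Gamma> B' id f" "b \<in> carrier B"
  shows "f (gmodule.norm_map \<Gamma> B b) = gmodule.norm_map \<Gamma> B' (f b)"
proof -
  interpret gmodule_morphism \<Gamma> B \<Gamma> B' id f by fact
  have "f (M.norm_map b) = finprod B' (\<lambda>\<gamma>. f (act B \<gamma> b)) (carrier \<Gamma>)"
    unfolding M.norm_map_def
    by (rule hom_finprod[OF M.B.comm_group_axioms M'.B.comm_group_axioms f_hom])
       (use assms(2) in \<open>auto intro: M.act_closed\<close>)
  also have "\<dots> = M'.norm_map (f b)"
    unfolding M'.norm_map_def
    by (rule M'.B.finprod_cong') (use assms(2) in \<open>auto intro: M'.act_closed simp: f_act\<close>)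
  finally show ?thesis .
qed


lemma gmodule_morphism_compose:
  assumes "gmodule_morphism \<Gamma> B \<Gamma>' B' \<phi> f" "gmodule_morphism \<Gamma>' B' \<Gamma>'' B'' \<psi> g"
  shows "gmodule_morphism \<Gamma> B \<Gamma>'' B'' (\<psi> \<circ> \<phi>) (g \<circ> f)"
proof -
  interpret f: gmodule_morphism \<Gamma> B \<Gamma>' B' \<phi> f by fact
  interpret g: gmodule_morphism \<Gamma>' B' \<Gamma>'' B'' \<psi> g by fact
  show ?thesis
  proof unfold_locales
    show "\<psi> \<circ> \<phi> \<in> hom \<Gamma> \<Gamma>''" using f.phi g.phi by (rule hom_compose)
    have "g \<circ> f \<in> hom B B''" using f.f_hom g.f_hom by (rule hom_compose)
    then show "g \<circ> f \<in> gmodule_hom \<Gamma> (\<psi> \<circ> \<phi>) B B''"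
      using hom_in_carrier[OF f.phi] by (auto simp: gmodule_hom_def f.f_act g.f_act)
  qed
qed

text \<open>Stated for a diagonal \<open>h\<close> instead of \<open>g \<circ> f\<close>, so that a commutative square can be split into two
  triangles with the same diagonal.\<close>

lemma
  assumes "gmodule_morphism \<Gamma> B \<Gamma>' B' \<phi> f" "gmodule_morphism \<Gamma>' B' \<Gamma>'' B'' \<psi> g"
    "gmodule_morphism \<Gamma> B \<Gamma>'' B'' \<chi> h" and eq: "\<And>b. b \<in> carrier B \<Longrightarrow> h b = g (f b)"
  shows coinv_map_triangle: "x \<in> carrier (coinv \<Gamma> B) \<Longrightarrow>
          coinv_map \<Gamma>'' B'' h x = coinv_map \<Gamma>'' B'' g (coinv_map \<Gamma>' B' f x)"
    and QZ_coinv_map_triangle: "t \<in> carrier (QZ_coinv \<Gamma> B) \<Longrightarrow>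
          QZ_coinv_map \<Gamma>'' B'' h t = QZ_coinv_map \<Gamma>'' B'' g (QZ_coinv_map \<Gamma>' B' f t)"
proof -
  interpret f: gmodule_morphism \<Gamma> B \<Gamma>' B' \<phi> f by fact
  interpret g: gmodule_morphism \<Gamma>' B' \<Gamma>'' B'' \<psi> g by fact
  interpret h: gmodule_morphism \<Gamma> B \<Gamma>'' B'' \<chi> h by fact
  show *: "coinv_map \<Gamma>'' B'' h x = coinv_map \<Gamma>'' B'' g (coinv_map \<Gamma>' B' f x)"
    if "x \<in> carrier (coinv \<Gamma> B)" for x
    using that by (auto simp: f.M.carrier_coinv f.coinv_map_class g.coinv_map_class h.coinv_map_class eq)
  assume "t \<in> carrier (QZ_coinv \<Gamma> B)"
  then obtain n z where z: "z \<in> carrier (coinv \<Gamma> B)" "t = frac_tensor (coinv \<Gamma> B) n z"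
    unfolding QZ_coinv_def by (rule f.M.C.tensor_QZ_fracE)
  then show "QZ_coinv_map \<Gamma>'' B'' h t = QZ_coinv_map \<Gamma>'' B'' g (QZ_coinv_map \<Gamma>' B' f t)"
    using hom_in_carrier[OF f.coinv_map_hom z(1)]
    by (simp add: f.QZ_coinv_map_frac g.QZ_coinv_map_frac h.QZ_coinv_map_frac *)
qed

lemma
  assumes "is_gmodule \<Gamma> B"
  shows coinv_map_id: "x \<in> carrier (coinv \<Gamma> B) \<Longrightarrow> coinv_map \<Gamma> B id x = x"
    and QZ_coinv_map_id: "t \<in> carrier (QZ_coinv \<Gamma> B) \<Longrightarrow> QZ_coinv_map \<Gamma> B id t = t"
proof -
  interpret gmodule \<Gamma> B using assms by unfold_locales
  interpret I: gmodule_morphism \<Gamma> B \<Gamma> B id id by (rule identity_morphism)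
  show *: "coinv_map \<Gamma> B id x = x" if "x \<in> carrier (coinv \<Gamma> B)" for x
    using that by (auto simp: carrier_coinv I.coinv_map_class)
  assume "t \<in> carrier (QZ_coinv \<Gamma> B)"
  then obtain n z where "z \<in> carrier (coinv \<Gamma> B)" "t = frac_tensor (coinv \<Gamma> B) n z"
    unfolding QZ_coinv_def by (rule C.tensor_QZ_fracE)
  then show "QZ_coinv_map \<Gamma> B id t = t" by (simp add: I.QZ_coinv_map_frac *)
qed

section \<open>The six-term sequence\<close>

locale gmod_short_exact =
  fixes S :: "('g, 'a, 'b, 'c) gmod_seq"
  assumes short_exact: "short_exact S"
begin

abbreviation "C1 \<equiv> coinv (Grp S) (M1 S)"
abbreviation "C2 \<equiv> coinv (Grp S) (M2 S)"
abbreviation "C3 \<equiv> coinv (Grp S) (M3 S)"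
abbreviation "cl1 \<equiv> coinv_class (Grp S) (M1 S)"
abbreviation "cl2 \<equiv> coinv_class (Grp S) (M2 S)"
abbreviation "cl3 \<equiv> coinv_class (Grp S) (M3 S)"
abbreviation "inc_coinv \<equiv> coinv_map (Grp S) (M2 S) (inc S)"
abbreviation "prj_coinv \<equiv> coinv_map (Grp S) (M3 S) (prj S)"

lemma
  shows finite_group: "finite (carrier (Grp S))"
    and inc_inj: "inj_on (inc S) (carrier (M1 S))"
    and inc_image: "inc S ` carrier (M1 S) = kernel (M2 S) (M3 S) (prj S)"
    and prj_surj: "prj S ` carrier (M2 S) = carrier (M3 S)"
  using short_exact by (simp_all add: short_exact_def exact_at_def)

sublocale m1: gmodule "Grp S" "M1 S"
  using short_exact by unfold_locales (simp add: short_exact_def)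
sublocale m2: gmodule "Grp S" "M2 S"
  using short_exact by unfold_locales (simp add: short_exact_def)
sublocale m3: gmodule "Grp S" "M3 S"
  using short_exact by unfold_locales (simp add: short_exact_def)

lemma id_hom: "id \<in> hom (Grp S) (Grp S)"
  by (simp add: hom_def)

sublocale inc: gmodule_morphism "Grp S" "M1 S" "Grp S" "M2 S" id "inc S"
  using short_exact id_hom by unfold_locales (simp_all add: short_exact_def)
sublocale prj: gmodule_morphism "Grp S" "M2 S" "Grp S" "M3 S" id "prj S"
  using short_exact id_hom by unfold_locales (simp_all add: short_exact_def)

lemma prj_inc: "x \<in> carrier (M1 S) \<Longrightarrow> prj S (inc S x) = \<one>\<^bsub>M3 S\<^esub>"
  using imageI[of x "carrier (M1 S)" "inc S"] unfolding inc_image by (simp add: kernel_def)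

lemma kernel_prjE:
  assumes "y \<in> carrier (M2 S)" "prj S y = \<one>\<^bsub>M3 S\<^esub>"
  obtains x where "x \<in> carrier (M1 S)" "y = inc S x"
proof -
  from assms have "y \<in> inc S ` carrier (M1 S)" unfolding inc_image by (simp add: kernel_def)
  then show ?thesis by (rule imageE) (rule that)
qed

lemma lift_cochain:
  assumes y3: "y3 \<in> carrier (Grp S) \<rightarrow> carrier (M3 S)"
  obtains y2 where "y2 \<in> carrier (Grp S) \<rightarrow> carrier (M2 S)"
    "\<forall>\<gamma>\<in>carrier (Grp S). prj S (y2 \<gamma>) = y3 \<gamma>"
proof
  have y3_image: "y3 \<gamma> \<in> prj S ` carrier (M2 S)" if "\<gamma> \<in> carrier (Grp S)" for \<gamma>
    using y3 that unfolding prj_surj by (rule funcset_mem)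
  show "(\<lambda>\<gamma>. inv_into (carrier (M2 S)) (prj S) (y3 \<gamma>)) \<in> carrier (Grp S) \<rightarrow> carrier (M2 S)"
    by (intro funcsetI inv_into_into y3_image)
  show "\<forall>\<gamma>\<in>carrier (Grp S). prj S (inv_into (carrier (M2 S)) (prj S) (y3 \<gamma>)) = y3 \<gamma>"
    by (intro ballI f_inv_into_f y3_image)
qed

lemma prj_act_sum:
  "y2 \<in> carrier (Grp S) \<rightarrow> carrier (M2 S) \<Longrightarrow>
     \<forall>\<gamma>\<in>carrier (Grp S). prj S (y2 \<gamma>) = y3 \<gamma> \<Longrightarrow>
     prj S (act_sum (Grp S) (M2 S) y2) = act_sum (Grp S) (M3 S) y3"
  by (rule hom_act_sum[OF prj.gmodule_morphism_axioms]) simp_all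

text \<open>If \<open>x\<close> maps to zero in the coinvariants of \<open>B\<^sub>2\<close>, then the norm kills \<open>i x\<close>; as the norm
  commutes with the injective map \<open>i\<close>, it kills \<open>x\<close>, and \<open>|\<Gamma>|\<close> annihilates the class of \<open>x\<close>.\<close>

lemma inc_coinv_one_imp_torsion:
  assumes c: "c \<in> carrier C1" "inc_coinv c = \<one>\<^bsub>C2\<^esub>"
  shows "c \<in> torsion C1"
proof -
  from c(1) obtain x where x: "x \<in> carrier (M1 S)" "c = cl1 x"
    unfolding m1.carrier_coinv by blast
  have ix: "inc S x \<in> carrier (M2 S)" using x(1) by (rule inc.f.hom_closed)
  have "inc S x \<in> coinv_rel (Grp S) (M2 S)"
    using c(2) unfolding x(2) inc.coinv_map_class[OF x(1)] m2.coinv_class_eq_one_iff[OF ix] .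
  then have "inc S (m1.norm_map x) = \<one>\<^bsub>M2 S\<^esub>"
    unfolding norm_map_natural[OF inc.gmodule_morphism_axioms x(1)] by (rule m2.norm_map_coinv_rel)
  then have "inc S (m1.norm_map x) = inc S \<one>\<^bsub>M1 S\<^esub>" by simp
  then have "m1.norm_map x = \<one>\<^bsub>M1 S\<^esub>"
    by (rule inj_onD[OF inc_inj]) (use x in auto)
  then show ?thesis
    unfolding x(2) by (rule m1.norm_map_one_imp_torsion[OF finite_group x(1)])
qed

text \<open>For exactness in the middle, let the class of \<open>x \<in> B\<^sub>2\<close> die in the coinvariants of \<open>B\<^sub>3\<close>. Then \<open>j x\<close> is a
  sum of elements \<open>\<^sup>\<gamma>y - y\<close>. Lifting the \<open>y\<close> to \<open>B\<^sub>2\<close> and subtracting the corresponding sum from \<open>x\<close> does not change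
  the class of \<open>x\<close> and makes it an element of \<open>i B\<^sub>1\<close>.\<close>

sublocale seq: torsion_kernel_sequence C1 C2 C3 inc_coinv prj_coinv
proof unfold_locales
  show "inc_coinv \<in> hom C1 C2" by (rule inc.coinv_map_hom)
  show "prj_coinv \<in> hom C2 C3" by (rule prj.coinv_map_hom)
  show "inc_coinv ` carrier C1 = kernel C2 C3 prj_coinv"
  proof (intro equalityI subsetI)
    fix c assume "c \<in> inc_coinv ` carrier C1"
    then obtain x where x: "x \<in> carrier (M1 S)" "c = inc_coinv (cl1 x)"
      unfolding m1.carrier_coinv by blast
    have ix: "inc S x \<in> carrier (M2 S)" using x(1) by (rule inc.f.hom_closed)
    have "c = cl2 (inc S x)" unfolding x(2) by (rule inc.coinv_map_class[OF x(1)])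
    then show "c \<in> kernel C2 C3 prj_coinv"
      using ix by (simp add: kernel_def prj.coinv_map_class prj_inc[OF x(1)])
  next
    fix c assume "c \<in> kernel C2 C3 prj_coinv"
    then have c: "c \<in> carrier C2" "prj_coinv c = \<one>\<^bsub>C3\<^esub>" by (simp_all add: kernel_def)
    from c(1) obtain x where x: "x \<in> carrier (M2 S)" "c = cl2 x"
      unfolding m2.carrier_coinv by blast
    have px: "prj S x \<in> carrier (M3 S)" using x(1) by (rule prj.f.hom_closed)
    have "prj S x \<in> coinv_rel (Grp S) (M3 S)"
      using c(2) unfolding x(2) prj.coinv_map_class[OF x(1)] m3.coinv_class_eq_one_iff[OF px] .
    then obtain y3 where y3: "y3 \<in> carrier (Grp S) \<rightarrow> carrier (M3 S)" "prj S x = act_sum (Grp S) (M3 S) y3"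
      by (rule m3.coinv_rel_act_sumE[OF finite_group])
    from y3(1) obtain y2 where y2: "y2 \<in> carrier (Grp S) \<rightarrow> carrier (M2 S)"
      "\<forall>\<gamma>\<in>carrier (Grp S). prj S (y2 \<gamma>) = y3 \<gamma>" by (rule lift_cochain)
    let ?s = "act_sum (Grp S) (M2 S) y2"
    have s: "?s \<in> carrier (M2 S)" using y2(1) by (rule m2.act_sum_closed)
    have ps: "prj S ?s = prj S x" unfolding y3(2) using y2 by (rule prj_act_sum)
    have "prj S (x \<otimes>\<^bsub>M2 S\<^esub> inv\<^bsub>M2 S\<^esub> ?s) = \<one>\<^bsub>M3 S\<^esub>"
      using x(1) s px by (simp add: ps)
    with x(1) s obtain z where z: "z \<in> carrier (M1 S)" "x \<otimes>\<^bsub>M2 S\<^esub> inv\<^bsub>M2 S\<^esub> ?s = inc S z"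
      using kernel_prjE[of "x \<otimes>\<^bsub>M2 S\<^esub> inv\<^bsub>M2 S\<^esub> ?s"] by auto
    have "cl2 ?s = \<one>\<^bsub>C2\<^esub>"
      unfolding m2.coinv_class_eq_one_iff[OF s] using y2(1) by (rule m2.act_sum_in_coinv_rel)
    then have "c = cl2 (x \<otimes>\<^bsub>M2 S\<^esub> inv\<^bsub>M2 S\<^esub> ?s)" using x s by simp
    also have "\<dots> = inc_coinv (cl1 z)" unfolding z(2) by (rule inc.coinv_map_class[OF z(1), symmetric])
    finally show "c \<in> inc_coinv ` carrier C1" using z(1) by simp
  qed
  show "prj_coinv ` carrier C2 = carrier C3"
  proof -
    have "prj_coinv ` carrier C2 = (\<lambda>x. cl3 (prj S x)) ` carrier (M2 S)"
      unfolding m2.carrier_coinv image_image by (rule image_cong) (simp_all add: prj.coinv_map_class)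
    also have "\<dots> = carrier C3" unfolding m3.carrier_coinv prj_surj[symmetric] image_image ..
    finally show ?thesis .
  qed
  show "c \<in> torsion C1" if "c \<in> carrier C1" "inc_coinv c = \<one>\<^bsub>C2\<^esub>" for c
    using that by (rule inc_coinv_one_imp_torsion)
qed

text \<open>The bridge from the recipe for \<open>\<delta>\<close>, which takes place in the modules, to the abstract connecting
  relation: the sums of elements \<open>\<^sup>\<gamma>y - y\<close> vanish in the coinvariants.\<close>

lemma delta_data_connects:
  assumes "delta_data S x3 n z1"
  shows "seq.connects (cl3 x3) n (cl1 z1)"
proof -
  from assms obtain y3 x2 y2 where
    *: "n > 0" "z1 \<in> carrier (M1 S)" "x2 \<in> carrier (M2 S)" "prj S x2 = x3"
      "y2 \<in> carrier (Grp S) \<rightarrow> carrier (M2 S)"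
      "inc S z1 = x2 [^]\<^bsub>M2 S\<^esub> n \<otimes>\<^bsub>M2 S\<^esub> inv\<^bsub>M2 S\<^esub> act_sum (Grp S) (M2 S) y2"
    unfolding delta_data_def by blast
  let ?s = "act_sum (Grp S) (M2 S) y2"
  have s: "?s \<in> carrier (M2 S)" using *(5) by (rule m2.act_sum_closed)
  have "cl2 ?s = \<one>\<^bsub>C2\<^esub>"
    unfolding m2.coinv_class_eq_one_iff[OF s] using *(5) by (rule m2.act_sum_in_coinv_rel)
  then have "inc_coinv (cl1 z1) = cl2 x2 [^]\<^bsub>C2\<^esub> n"
    unfolding inc.coinv_map_class[OF *(2)] *(6) using *(3) s by (simp add: m2.cl.hom_nat_pow)
  then have "seq.connects (prj_coinv (cl2 x2)) n (cl1 z1)"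
    using * by (intro seq.connectsI) simp_all
  then show ?thesis unfolding prj.coinv_map_class[OF *(3)] *(4) .
qed

lemma delta_data_exists:
  assumes x3: "x3 \<in> carrier (M3 S)" and "cl3 x3 \<in> torsion C3"
  obtains n z1 where "delta_data S x3 n z1"
proof -
  from assms(2) obtain n :: nat where n: "n > 0" "cl3 x3 [^]\<^bsub>C3\<^esub> n = \<one>\<^bsub>C3\<^esub>"
    by (auto simp: torsion_def)
  have xn: "x3 [^]\<^bsub>M3 S\<^esub> n \<in> carrier (M3 S)" using x3 by simp
  have "cl3 (x3 [^]\<^bsub>M3 S\<^esub> n) = \<one>\<^bsub>C3\<^esub>" using n(2) m3.cl.hom_nat_pow[OF x3] by simp
  then have "x3 [^]\<^bsub>M3 S\<^esub> n \<in> coinv_rel (Grp S) (M3 S)"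
    unfolding m3.coinv_class_eq_one_iff[OF xn] .
  then obtain y3 where y3: "y3 \<in> carrier (Grp S) \<rightarrow> carrier (M3 S)"
    "x3 [^]\<^bsub>M3 S\<^esub> n = act_sum (Grp S) (M3 S) y3"
    by (rule m3.coinv_rel_act_sumE[OF finite_group])
  from y3(1) obtain y2 where y2: "y2 \<in> carrier (Grp S) \<rightarrow> carrier (M2 S)"
    "\<forall>\<gamma>\<in>carrier (Grp S). prj S (y2 \<gamma>) = y3 \<gamma>" by (rule lift_cochain)
  let ?s = "act_sum (Grp S) (M2 S) y2"
  have s: "?s \<in> carrier (M2 S)" using y2(1) by (rule m2.act_sum_closed)
  have ps: "prj S ?s = x3 [^]\<^bsub>M3 S\<^esub> n" unfolding y3(2) using y2 by (rule prj_act_sum)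
  from x3 obtain x2 where x2: "x2 \<in> carrier (M2 S)" "prj S x2 = x3"
    unfolding prj_surj[symmetric] by blast
  have "prj S (x2 [^]\<^bsub>M2 S\<^esub> n) = x3 [^]\<^bsub>M3 S\<^esub> n"
    unfolding x2(2)[symmetric] by (rule prj.f.hom_nat_pow[OF x2(1)])
  then have "prj S (x2 [^]\<^bsub>M2 S\<^esub> n \<otimes>\<^bsub>M2 S\<^esub> inv\<^bsub>M2 S\<^esub> ?s) = \<one>\<^bsub>M3 S\<^esub>"
    using x2(1) s xn by (simp add: ps)
  with x2(1) s obtain z where z: "z \<in> carrier (M1 S)" "x2 [^]\<^bsub>M2 S\<^esub> n \<otimes>\<^bsub>M2 S\<^esub> inv\<^bsub>M2 S\<^esub> ?s = inc S z"
    using kernel_prjE[of "x2 [^]\<^bsub>M2 S\<^esub> n \<otimes>\<^bsub>M2 S\<^esub> inv\<^bsub>M2 S\<^esub> ?s"] by auto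
  have "delta_data S x3 n z"
    unfolding delta_data_def using x3 n(1) z y3 x2 y2 by (intro conjI exI[of _ y3] exI[of _ x2] exI[of _ y2]) auto
  then show ?thesis by (rule that)
qed

lemma QZ_coinv_tf_iso:
  "QZ_coinv_tf (Grp S) (M1 S) \<in> iso (QZ_coinv (Grp S) (M1 S)) (tensor QZ (tors_free C1))"
  unfolding QZ_coinv_tf_def QZ_coinv_def by (rule tors_free_tensor_iso[OF m1.comm_group_coinv])

lemma QZ_coinv_tf_frac:
  "z1 \<in> carrier (M1 S) \<Longrightarrow> QZ_coinv_tf (Grp S) (M1 S) (frac_tensor C1 n (cl1 z1)) = delta_value S n z1"
  unfolding QZ_coinv_tf_def delta_value_def frac_tensor_def[symmetric]
  by (intro tensor_map_frac m1.comm_group_coinv comm_group_tors_free tors_free_proj_hom) simp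

text \<open>The element singled out in the definition of \<^const>\<open>delta\<close> is unique because the comparison with the
  torsion-free quotient is injective and because the connecting relation determines its value.\<close>

lemma delta_eq_of_data:
  assumes "delta_data S x3 n z1"
  shows "delta S (cl3 x3) = frac_tensor C1 n (cl1 z1)"
  unfolding delta_def
proof (rule the_equality)
  have z1: "z1 \<in> carrier (M1 S)" using assms by (simp add: delta_data_def)
  show "frac_tensor C1 n (cl1 z1) \<in> carrier (QZ_coinv (Grp S) (M1 S)) \<and>
    (\<exists>x n' z. delta_data S x n' z \<and> cl3 x = cl3 x3 \<and>
      QZ_coinv_tf (Grp S) (M1 S) (frac_tensor C1 n (cl1 z1)) = delta_value S n' z)"
    using assms z1 QZ_coinv_tf_frac[OF z1] m1.C.frac_tensor_closed[OF m1.cl.hom_closed[OF z1]]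
    unfolding QZ_coinv_def by blast
next
  fix t assume "t \<in> carrier (QZ_coinv (Grp S) (M1 S)) \<and>
    (\<exists>x n' z. delta_data S x n' z \<and> cl3 x = cl3 x3 \<and> QZ_coinv_tf (Grp S) (M1 S) t = delta_value S n' z)"
  then obtain x n' z where t: "t \<in> carrier (QZ_coinv (Grp S) (M1 S))" "delta_data S x n' z" "cl3 x = cl3 x3"
    "QZ_coinv_tf (Grp S) (M1 S) t = delta_value S n' z" by blast
  have z: "z \<in> carrier (M1 S)" using t(2) by (simp add: delta_data_def)
  have "inj_on (QZ_coinv_tf (Grp S) (M1 S)) (carrier (QZ_coinv (Grp S) (M1 S)))"
    using QZ_coinv_tf_iso by (simp add: iso_def bij_betw_def)
  then have "t = frac_tensor C1 n' (cl1 z)"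
  proof (rule inj_onD)
    show "QZ_coinv_tf (Grp S) (M1 S) t = QZ_coinv_tf (Grp S) (M1 S) (frac_tensor C1 n' (cl1 z))"
      unfolding t(4) by (rule QZ_coinv_tf_frac[OF z, symmetric])
    show "frac_tensor C1 n' (cl1 z) \<in> carrier (QZ_coinv (Grp S) (M1 S))"
      unfolding QZ_coinv_def by (rule m1.C.frac_tensor_closed[OF m1.cl.hom_closed[OF z]])
  qed (rule t(1))
  also have "\<dots> = frac_tensor C1 n (cl1 z1)"
    using delta_data_connects[OF t(2)] delta_data_connects[OF assms] unfolding t(3)
    by (rule seq.connects_unique)
  finally show "t = frac_tensor C1 n (cl1 z1)" .
qed

lemma delta_eq_of_connects:
  assumes "seq.connects c n z"
  shows "delta S c = frac_tensor C1 n z"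
proof -
  have c: "c \<in> torsion C3" using assms by (rule seq.connects_torsion)
  then have "c \<in> carrier C3" by (simp add: torsion_def)
  then obtain x3 where x3: "x3 \<in> carrier (M3 S)" "c = cl3 x3" unfolding m3.carrier_coinv by blast
  obtain m z1 where d: "delta_data S x3 m z1"
    using c unfolding x3(2) by (rule delta_data_exists[OF x3(1)])
  have "seq.connects c m (cl1 z1)" unfolding x3(2) using d by (rule delta_data_connects)
  then have "frac_tensor C1 m (cl1 z1) = frac_tensor C1 n z"
    using assms by (rule seq.connects_unique)
  then show ?thesis unfolding x3(2) delta_eq_of_data[OF d] .
qed

lemma delta_given_by_recipe:
  assumes "x3 \<in> carrier (M3 S)" "cl3 x3 \<in> torsion C3"
  shows "(\<exists>n z1. delta_data S x3 n z1) \<and>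
    (\<forall>n z1. delta_data S x3 n z1 \<longrightarrow> QZ_coinv_tf (Grp S) (M1 S) (delta S (cl3 x3)) = delta_value S n z1)"
proof (intro conjI allI impI)
  show "\<exists>n z1. delta_data S x3 n z1" using delta_data_exists[OF assms] by blast
  fix n z1 assume d: "delta_data S x3 n z1"
  then have "z1 \<in> carrier (M1 S)" by (simp add: delta_data_def)
  then show "QZ_coinv_tf (Grp S) (M1 S) (delta S (cl3 x3)) = delta_value S n z1"
    unfolding delta_eq_of_data[OF d] by (rule QZ_coinv_tf_frac)
qed

lemma six_term_exact:
  "exact_at (Tors C1) inc_coinv (Tors C2) prj_coinv (Tors C3) \<and>
   exact_at (Tors C2) prj_coinv (Tors C3) (delta S) (QZ_coinv (Grp S) (M1 S)) \<and>
   exact_at (Tors C3) (delta S) (QZ_coinv (Grp S) (M1 S))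
     (QZ_coinv_map (Grp S) (M2 S) (inc S)) (QZ_coinv (Grp S) (M2 S)) \<and>
   exact_at (QZ_coinv (Grp S) (M1 S)) (QZ_coinv_map (Grp S) (M2 S) (inc S))
     (QZ_coinv (Grp S) (M2 S)) (QZ_coinv_map (Grp S) (M3 S) (prj S)) (QZ_coinv (Grp S) (M3 S)) \<and>
   QZ_coinv_map (Grp S) (M3 S) (prj S) ` carrier (QZ_coinv (Grp S) (M2 S)) = carrier (QZ_coinv (Grp S) (M3 S))"
  unfolding QZ_coinv_def QZ_coinv_map_def
  using seq.exact_at_torsion seq.exact_at_connecting_source[OF delta_eq_of_connects]
    seq.exact_at_connecting_target[OF delta_eq_of_connects] seq.exact_at_tensor seq.Qj_surj
  by (intro conjI)

end

section \<open>Functoriality\<close>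

lemma coinv_map_Tors_hom:
  assumes "gmodule_morphism \<Gamma> B \<Gamma>' B' \<phi> f"
  shows "coinv_map \<Gamma>' B' f \<in> hom (Tors (coinv \<Gamma> B)) (Tors (coinv \<Gamma>' B'))"
proof -
  interpret gmodule_morphism \<Gamma> B \<Gamma>' B' \<phi> f by fact
  show ?thesis by (intro hom_Tors coinv_map_hom M.C.is_group M'.C.is_group)
qed

locale gmod_seq_morphism =
  S: gmod_short_exact S + S': gmod_short_exact S'
  for S :: "('g, 'a, 'b, 'c) gmod_seq" and S' :: "('g1, 'a1, 'b1, 'c1) gmod_seq" +
  fixes \<phi> f1 f2 f3
  assumes seq_hom: "seq_hom S S' \<phi> f1 f2 f3"
begin

lemma
  shows morphism1: "gmodule_morphism (Grp S) (M1 S) (Grp S') (M1 S') \<phi> f1"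
    and morphism2: "gmodule_morphism (Grp S) (M2 S) (Grp S') (M2 S') \<phi> f2"
    and morphism3: "gmodule_morphism (Grp S) (M3 S) (Grp S') (M3 S') \<phi> f3"
    and square_inc: "x \<in> carrier (M1 S) \<Longrightarrow> f2 (inc S x) = inc S' (f1 x)"
    and square_prj: "y \<in> carrier (M2 S) \<Longrightarrow> f3 (prj S y) = prj S' (f2 y)"
proof -
  note h = seq_hom[unfolded seq_hom_def]
  show "gmodule_morphism (Grp S) (M1 S) (Grp S') (M1 S') \<phi> f1"
    by (intro gmodule_morphism.intro gmodule_morphism_axioms.intro S.m1.gmodule_axioms S'.m1.gmodule_axioms)
       (use h in blast)+
  show "gmodule_morphism (Grp S) (M2 S) (Grp S') (M2 S') \<phi> f2"
    by (intro gmodule_morphism.intro gmodule_morphism_axioms.intro S.m2.gmodule_axioms S'.m2.gmodule_axioms)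
       (use h in blast)+
  show "gmodule_morphism (Grp S) (M3 S) (Grp S') (M3 S') \<phi> f3"
    by (intro gmodule_morphism.intro gmodule_morphism_axioms.intro S.m3.gmodule_axioms S'.m3.gmodule_axioms)
       (use h in blast)+
  show "f2 (inc S x) = inc S' (f1 x)" if "x \<in> carrier (M1 S)" for x
    using h that by blast
  show "f3 (prj S y) = prj S' (f2 y)" if "y \<in> carrier (M2 S)" for y
    using h that by blast
qed

sublocale f1: gmodule_morphism "Grp S" "M1 S" "Grp S'" "M1 S'" \<phi> f1 by (rule morphism1)
sublocale f2: gmodule_morphism "Grp S" "M2 S" "Grp S'" "M2 S'" \<phi> f2 by (rule morphism2)
sublocale f3: gmodule_morphism "Grp S" "M3 S" "Grp S'" "M3 S'" \<phi> f3 by (rule morphism3)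

lemma inc_diagonal: "gmodule_morphism (Grp S) (M1 S) (Grp S') (M2 S') (\<phi> \<circ> id) (f2 \<circ> inc S)"
  by (rule gmodule_morphism_compose[OF S.inc.gmodule_morphism_axioms morphism2])

lemma prj_diagonal: "gmodule_morphism (Grp S) (M2 S) (Grp S') (M3 S') (\<phi> \<circ> id) (f3 \<circ> prj S)"
  by (rule gmodule_morphism_compose[OF S.prj.gmodule_morphism_axioms morphism3])

lemmas inc_triangles = 
  S.inc.gmodule_morphism_axioms morphism2 inc_diagonal
  morphism1 S'.inc.gmodule_morphism_axioms inc_diagonal

lemma coinv_square_inc:
  assumes "x \<in> carrier (coinv (Grp S) (M1 S))"
  shows "coinv_map (Grp S') (M2 S') f2 (coinv_map (Grp S) (M2 S) (inc S) x)
    = coinv_map (Grp S') (M2 S') (inc S') (coinv_map (Grp S') (M1 S') f1 x)"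
  by (rule trans[OF coinv_map_triangle[OF inc_triangles(1-3) _ assms, symmetric]
        coinv_map_triangle[OF inc_triangles(4-6) _ assms]]) (simp_all add: square_inc)

lemma QZ_coinv_square_inc:
  assumes "t \<in> carrier (QZ_coinv (Grp S) (M1 S))"
  shows "QZ_coinv_map (Grp S') (M2 S') f2 (QZ_coinv_map (Grp S) (M2 S) (inc S) t)
    = QZ_coinv_map (Grp S') (M2 S') (inc S') (QZ_coinv_map (Grp S') (M1 S') f1 t)"
  by (rule trans[OF QZ_coinv_map_triangle[OF inc_triangles(1-3) _ assms, symmetric]
        QZ_coinv_map_triangle[OF inc_triangles(4-6) _ assms]]) (simp_all add: square_inc)

lemmas prj_triangles = 
  S.prj.gmodule_morphism_axioms morphism3 prj_diagonal
  morphism2 S'.prj.gmodule_morphism_axioms prj_diagonal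

lemma coinv_square_prj:
  assumes "x \<in> carrier (coinv (Grp S) (M2 S))"
  shows "coinv_map (Grp S') (M3 S') f3 (coinv_map (Grp S) (M3 S) (prj S) x)
    = coinv_map (Grp S') (M3 S') (prj S') (coinv_map (Grp S') (M2 S') f2 x)"
  by (rule trans[OF coinv_map_triangle[OF prj_triangles(1-3) _ assms, symmetric]
        coinv_map_triangle[OF prj_triangles(4-6) _ assms]]) (simp_all add: square_prj)

lemma QZ_coinv_square_prj:
  assumes "t \<in> carrier (QZ_coinv (Grp S) (M2 S))"
  shows "QZ_coinv_map (Grp S') (M3 S') f3 (QZ_coinv_map (Grp S) (M3 S) (prj S) t)
    = QZ_coinv_map (Grp S') (M3 S') (prj S') (QZ_coinv_map (Grp S') (M2 S') f2 t)"
  by (rule trans[OF QZ_coinv_map_triangle[OF prj_triangles(1-3) _ assms, symmetric]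
        QZ_coinv_map_triangle[OF prj_triangles(4-6) _ assms]]) (simp_all add: square_prj)

text \<open>The image of a lift is a lift of the image.\<close>

lemma connects_natural:
  assumes "S.seq.connects c n z"
  shows "S'.seq.connects (coinv_map (Grp S') (M3 S') f3 c) n (coinv_map (Grp S') (M1 S') f1 z)"
proof -
  from assms obtain a where a: "n > 0" "z \<in> carrier S.C1" "a \<in> carrier S.C2" "c = S.prj_coinv a"
    "a [^]\<^bsub>S.C2\<^esub> n = S.inc_coinv z" by (rule S.seq.connectsE)
  let ?a = "coinv_map (Grp S') (M2 S') f2 a" and ?z = "coinv_map (Grp S') (M1 S') f1 z"
  have az: "?a \<in> carrier S'.C2" "?z \<in> carrier S'.C1"
    using a f1.coinv_map_hom f2.coinv_map_hom by (blast intro: hom_in_carrier)+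
  have "?a [^]\<^bsub>S'.C2\<^esub> n = coinv_map (Grp S') (M2 S') f2 (a [^]\<^bsub>S.C2\<^esub> n)"
    by (rule hom_nat_pow[OF f2.coinv_map_hom a(3) S.m2.C.is_group S'.m2.C.is_group, symmetric])
  also have "\<dots> = S'.inc_coinv ?z" unfolding a(5) by (rule coinv_square_inc[OF a(2)])
  finally have "S'.seq.connects (S'.prj_coinv ?a) n ?z" by (rule S'.seq.connectsI[OF a(1) az(2,1)])
  then show ?thesis unfolding a(4) coinv_square_prj[OF a(3)] .
qed

lemma delta_natural:
  assumes "c \<in> torsion S.C3"
  shows "QZ_coinv_map (Grp S') (M1 S') f1 (delta S c) = delta S' (coinv_map (Grp S') (M3 S') f3 c)"
proof -
  from assms obtain n z where nz: "S.seq.connects c n z" by (rule S.seq.connects_exists)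
  then have "z \<in> carrier S.C1" by (simp add: S.seq.connects_def)
  then show ?thesis
    unfolding S.delta_eq_of_connects[OF nz] S'.delta_eq_of_connects[OF connects_natural[OF nz]]
    by (rule f1.QZ_coinv_map_frac)
qed

end

lemma seq_hom_compose:
  assumes "gmod_seq_morphism S S' \<phi> f1 f2 f3" "gmod_seq_morphism S' S'' \<psi> g1 g2 g3"
  shows "seq_hom S S'' (\<psi> \<circ> \<phi>) (g1 \<circ> f1) (g2 \<circ> f2) (g3 \<circ> f3)"
proof -
  interpret f: gmod_seq_morphism S S' \<phi> f1 f2 f3 by fact
  interpret g: gmod_seq_morphism S' S'' \<psi> g1 g2 g3 by fact
  interpret c1: gmodule_morphism "Grp S" "M1 S" "Grp S''" "M1 S''" "\<psi> \<circ> \<phi>" "g1 \<circ> f1"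
    by (rule gmodule_morphism_compose[OF f.morphism1 g.morphism1])
  interpret c2: gmodule_morphism "Grp S" "M2 S" "Grp S''" "M2 S''" "\<psi> \<circ> \<phi>" "g2 \<circ> f2"
    by (rule gmodule_morphism_compose[OF f.morphism2 g.morphism2])
  interpret c3: gmodule_morphism "Grp S" "M3 S" "Grp S''" "M3 S''" "\<psi> \<circ> \<phi>" "g3 \<circ> f3"
    by (rule gmodule_morphism_compose[OF f.morphism3 g.morphism3])
  show ?thesis
    unfolding seq_hom_def
    using hom_in_carrier[OF f.f1.f_hom] hom_in_carrier[OF f.f2.f_hom]
    by (simp add: f.square_inc f.square_prj g.square_inc g.square_prj
        c1.phi c1.f_gmodule_hom c2.f_gmodule_hom c3.f_gmodule_hom)
qed


theorem theorem4p1: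
  fixes S :: "('g, 'a, 'b, 'c) gmod_seq"
    and S' :: "('g1, 'a1, 'b1, 'c1) gmod_seq"
    and S'' :: "('g2, 'a2, 'b2, 'c2) gmod_seq"
  assumes S: "short_exact S"
  shows
    \<comment> \<open>the identification used in the definition of \<open>\<delta>\<close>, and \<open>\<delta>\<close> is given by the recipe for all choices\<close>
    "(QZ_coinv_tf (Grp S) (M1 S)
        \<in> iso (QZ_coinv (Grp S) (M1 S)) (tensor QZ (tors_free (coinv (Grp S) (M1 S)))) \<and>
      (\<forall>x3\<in>carrier (M3 S). coinv_class (Grp S) (M3 S) x3 \<in> torsion (coinv (Grp S) (M3 S)) \<longrightarrow>
         (\<exists>n z1. delta_data S x3 n z1) \<and>
         (\<forall>n z1. delta_data S x3 n z1 \<longrightarrow>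
            QZ_coinv_tf (Grp S) (M1 S) (delta S (coinv_class (Grp S) (M3 S) x3)) = delta_value S n z1))) \<and>
    \<comment> \<open>exactness\<close>
     (exact_at
        (Tors (coinv (Grp S) (M1 S))) (coinv_map (Grp S) (M2 S) (inc S))
        (Tors (coinv (Grp S) (M2 S))) (coinv_map (Grp S) (M3 S) (prj S))
        (Tors (coinv (Grp S) (M3 S))) \<and>
      exact_at
        (Tors (coinv (Grp S) (M2 S))) (coinv_map (Grp S) (M3 S) (prj S))
        (Tors (coinv (Grp S) (M3 S))) (delta S)
        (QZ_coinv (Grp S) (M1 S)) \<and>
      exact_at
        (Tors (coinv (Grp S) (M3 S))) (delta S)
        (QZ_coinv (Grp S) (M1 S)) (QZ_coinv_map (Grp S) (M2 S) (inc S))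
        (QZ_coinv (Grp S) (M2 S)) \<and>
      exact_at
        (QZ_coinv (Grp S) (M1 S)) (QZ_coinv_map (Grp S) (M2 S) (inc S))
        (QZ_coinv (Grp S) (M2 S)) (QZ_coinv_map (Grp S) (M3 S) (prj S))
        (QZ_coinv (Grp S) (M3 S)) \<and>
      QZ_coinv_map (Grp S) (M3 S) (prj S) ` carrier (QZ_coinv (Grp S) (M2 S))
        = carrier (QZ_coinv (Grp S) (M3 S))) \<and>
    \<comment> \<open>functoriality: a morphism \<open>S \<rightarrow> S'\<close> induces a morphism of six-term sequences\<close>
     (\<forall>\<phi> f1 f2 f3. short_exact S' \<and> seq_hom S S' \<phi> f1 f2 f3 \<longrightarrow>
        coinv_map (Grp S') (M1 S') f1
          \<in> hom (Tors (coinv (Grp S) (M1 S))) (Tors (coinv (Grp S') (M1 S'))) \<and>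
        coinv_map (Grp S') (M2 S') f2
          \<in> hom (Tors (coinv (Grp S) (M2 S))) (Tors (coinv (Grp S') (M2 S'))) \<and>
        coinv_map (Grp S') (M3 S') f3
          \<in> hom (Tors (coinv (Grp S) (M3 S))) (Tors (coinv (Grp S') (M3 S'))) \<and>
        QZ_coinv_map (Grp S') (M1 S') f1
          \<in> hom (QZ_coinv (Grp S) (M1 S)) (QZ_coinv (Grp S') (M1 S')) \<and>
        QZ_coinv_map (Grp S') (M2 S') f2
          \<in> hom (QZ_coinv (Grp S) (M2 S)) (QZ_coinv (Grp S') (M2 S')) \<and>
        QZ_coinv_map (Grp S') (M3 S') f3
          \<in> hom (QZ_coinv (Grp S) (M3 S)) (QZ_coinv (Grp S') (M3 S')) \<and>
        (\<forall>x\<in>torsion (coinv (Grp S) (M1 S)).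
           coinv_map (Grp S') (M2 S') f2 (coinv_map (Grp S) (M2 S) (inc S) x)
             = coinv_map (Grp S') (M2 S') (inc S') (coinv_map (Grp S') (M1 S') f1 x)) \<and>
        (\<forall>x\<in>torsion (coinv (Grp S) (M2 S)).
           coinv_map (Grp S') (M3 S') f3 (coinv_map (Grp S) (M3 S) (prj S) x)
             = coinv_map (Grp S') (M3 S') (prj S') (coinv_map (Grp S') (M2 S') f2 x)) \<and>
        (\<forall>x\<in>torsion (coinv (Grp S) (M3 S)).
           QZ_coinv_map (Grp S') (M1 S') f1 (delta S x)
             = delta S' (coinv_map (Grp S') (M3 S') f3 x)) \<and>
        (\<forall>x\<in>carrier (QZ_coinv (Grp S) (M1 S)).
           QZ_coinv_map (Grp S') (M2 S') f2 (QZ_coinv_map (Grp S) (M2 S) (inc S) x)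
             = QZ_coinv_map (Grp S') (M2 S') (inc S') (QZ_coinv_map (Grp S') (M1 S') f1 x)) \<and>
        (\<forall>x\<in>carrier (QZ_coinv (Grp S) (M2 S)).
           QZ_coinv_map (Grp S') (M3 S') f3 (QZ_coinv_map (Grp S) (M3 S) (prj S) x)
             = QZ_coinv_map (Grp S') (M3 S') (prj S') (QZ_coinv_map (Grp S') (M2 S') f2 x))) \<and>
    \<comment> \<open>functoriality: identities\<close>
     ((\<forall>x\<in>torsion (coinv (Grp S) (M1 S)). coinv_map (Grp S) (M1 S) id x = x) \<and>
      (\<forall>x\<in>torsion (coinv (Grp S) (M2 S)). coinv_map (Grp S) (M2 S) id x = x) \<and>
      (\<forall>x\<in>torsion (coinv (Grp S) (M3 S)). coinv_map (Grp S) (M3 S) id x = x) \<and>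
      (\<forall>x\<in>carrier (QZ_coinv (Grp S) (M1 S)). QZ_coinv_map (Grp S) (M1 S) id x = x) \<and>
      (\<forall>x\<in>carrier (QZ_coinv (Grp S) (M2 S)). QZ_coinv_map (Grp S) (M2 S) id x = x) \<and>
      (\<forall>x\<in>carrier (QZ_coinv (Grp S) (M3 S)). QZ_coinv_map (Grp S) (M3 S) id x = x)) \<and>
    \<comment> \<open>functoriality: composition of \<open>S \<rightarrow> S' \<rightarrow> S''\<close>\<close>
     (\<forall>\<phi> f1 f2 f3 \<psi> g1 g2 g3.
        short_exact S' \<and> short_exact S'' \<and>
        seq_hom S S' \<phi> f1 f2 f3 \<and> seq_hom S' S'' \<psi> g1 g2 g3 \<longrightarrow>
        seq_hom S S'' (\<psi> \<circ> \<phi>) (g1 \<circ> f1) (g2 \<circ> f2) (g3 \<circ> f3) \<and>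
        (\<forall>x\<in>torsion (coinv (Grp S) (M1 S)).
           coinv_map (Grp S'') (M1 S'') (g1 \<circ> f1) x
             = coinv_map (Grp S'') (M1 S'') g1 (coinv_map (Grp S') (M1 S') f1 x)) \<and>
        (\<forall>x\<in>torsion (coinv (Grp S) (M2 S)).
           coinv_map (Grp S'') (M2 S'') (g2 \<circ> f2) x
             = coinv_map (Grp S'') (M2 S'') g2 (coinv_map (Grp S') (M2 S') f2 x)) \<and>
        (\<forall>x\<in>torsion (coinv (Grp S) (M3 S)).
           coinv_map (Grp S'') (M3 S'') (g3 \<circ> f3) x
             = coinv_map (Grp S'') (M3 S'') g3 (coinv_map (Grp S') (M3 S') f3 x)) \<and>
        (\<forall>x\<in>carrier (QZ_coinv (Grp S) (M1 S)).
           QZ_coinv_map (Grp S'') (M1 S'') (g1 \<circ> f1) x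
             = QZ_coinv_map (Grp S'') (M1 S'') g1 (QZ_coinv_map (Grp S') (M1 S') f1 x)) \<and>
        (\<forall>x\<in>carrier (QZ_coinv (Grp S) (M2 S)).
           QZ_coinv_map (Grp S'') (M2 S'') (g2 \<circ> f2) x
             = QZ_coinv_map (Grp S'') (M2 S'') g2 (QZ_coinv_map (Grp S') (M2 S') f2 x)) \<and>
        (\<forall>x\<in>carrier (QZ_coinv (Grp S) (M3 S)).
           QZ_coinv_map (Grp S'') (M3 S'') (g3 \<circ> f3) x
             = QZ_coinv_map (Grp S'') (M3 S'') g3 (QZ_coinv_map (Grp S') (M3 S') f3 x)))"
proof -
  interpret S: gmod_short_exact S using S by unfold_locales
  show ?thesis
  proof (rule conjI, goal_cases)
    case 1
    show ?case
      using S.QZ_coinv_tf_iso S.delta_given_by_recipe by (intro conjI ballI impI) blast+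
  next
    case 2
    show ?case
    proof (rule conjI[OF S.six_term_exact], rule conjI, goal_cases)
      case 1
      show ?case
      proof (intro allI impI, elim conjE, goal_cases)
        case (1 \<phi> f1 f2 f3)
        then interpret f: gmod_seq_morphism S S' \<phi> f1 f2 f3
          by (intro gmod_seq_morphism.intro gmod_short_exact.intro gmod_seq_morphism_axioms.intro S)
        show ?case
          by (intro conjI ballI coinv_map_Tors_hom[OF f.morphism1]
              coinv_map_Tors_hom[OF f.morphism2] coinv_map_Tors_hom[OF f.morphism3]
              f.f1.QZ_coinv_map_hom f.f2.QZ_coinv_map_hom f.f3.QZ_coinv_map_hom
              f.coinv_square_inc[OF torsion_imp_carrier] f.coinv_square_prj[OF torsion_imp_carrier]
              f.QZ_coinv_square_inc f.QZ_coinv_square_prj f.delta_natural)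
      qed
    next
      case 2
      show ?case
      proof (rule conjI, goal_cases)
        case 1
        show ?case
          by (intro conjI ballI coinv_map_id[OF _ torsion_imp_carrier] QZ_coinv_map_id
              S.m1.is_gmodule S.m2.is_gmodule S.m3.is_gmodule)
      next
        case 2
        show ?case
        proof (intro allI impI, elim conjE, goal_cases)
          case (1 \<phi> f1 f2 f3 \<psi> g1 g2 g3)
          then interpret f: gmod_seq_morphism S S' \<phi> f1 f2 f3
            by (intro gmod_seq_morphism.intro gmod_short_exact.intro gmod_seq_morphism_axioms.intro S)
          from 1 interpret g: gmod_seq_morphism S' S'' \<psi> g1 g2 g3
            by (intro gmod_seq_morphism.intro gmod_short_exact.intro gmod_seq_morphism_axioms.intro)
          note compose = gmodule_morphism_compose[OF f.morphism1 g.morphism1]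
            gmodule_morphism_compose[OF f.morphism2 g.morphism2]
            gmodule_morphism_compose[OF f.morphism3 g.morphism3]
          show ?case
            by (intro conjI ballI seq_hom_compose[OF f.gmod_seq_morphism_axioms g.gmod_seq_morphism_axioms]
                coinv_map_triangle[OF f.morphism1 g.morphism1 compose(1) comp_apply torsion_imp_carrier]
                coinv_map_triangle[OF f.morphism2 g.morphism2 compose(2) comp_apply torsion_imp_carrier]
                coinv_map_triangle[OF f.morphism3 g.morphism3 compose(3) comp_apply torsion_imp_carrier]
                QZ_coinv_map_triangle[OF f.morphism1 g.morphism1 compose(1) comp_apply]
                QZ_coinv_map_triangle[OF f.morphism2 g.morphism2 compose(2) comp_apply]
                QZ_coinv_map_triangle[OF f.morphism3 g.morphism3 compose(3) comp_apply])
        qed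
      qed
    qed
  qed
qed

end
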